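(* Let $w[1:n]$ be a string over a totally ordered alphabet and let $g_{rl}$ be the size of the smallest RLSLP generating $w$. Define, for positions $i$ and symbols $d$: $\mathrm{psv}(i)=\max(\{j : j<i,\ w[j]<w[i]\}\cup\{0\})$, $\mathrm{nsv}(i)=\min(\{j : j>i,\ w[j]<w[i]\}\cup\{n+1\})$, $\mathrm{psv}'(i,d)=\max(\{j : j<i,\ w[j]<d\}\cup\{0\})$, $\mathrm{nsv}'(i,d)=\min(\{j : j>i,\ w[j]<d\}\cup\{n+1\})$. Then it is possible to construct a data structure (index) of size $\mathcal{O}(g_{rl})$ that answers each of these previous-smaller-value and next-smaller-value queries in $\mathcal{O}(\log n)$ time.
   Context: A run-length straight-line program (RLSLP) is a context-free grammar in which each variable has exactly one rule, variables can be ordered so that each rule's right-hand side mentions only terminals and strictly smaller variables, and the rules have one of the forms $A\rightarrow a$ ($a$ a terminal), $A\rightarrow A_1\cdots A_k$ ($k>1$ variables), or $A\rightarrow B^t$ with integer $t>2$ (deriving $t$ concatenated copies of the string derived by $B$); it generates the unique string derived by its start variable. Its size is the sum of the lengths of the right-hand sides, with a rule $A\rightarrow B^t$ counting as size 2. Space is measured in machine words of $\Theta(\log n)$ bits. *)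

theory Defs
  imports Complex_Main "HOL-Library.Landau_Symbols"
begin

text \<open>
  Run-length straight-line programs. Variables are natural numbers; the rule map is a partial
  function, so every variable in its domain has exactly one rule.
\<close>

datatype 'a rhs =
    Terminal 'a
  | Concat "nat list"
  | Power nat nat

fun rhs_vars :: "'a rhs \<Rightarrow> nat set" where
  "rhs_vars (Terminal a) = {}"
| "rhs_vars (Concat Bs) = set Bs"
| "rhs_vars (Power B t) = {B}"

fun rhs_wf :: "'a rhs \<Rightarrow> bool" where
  "rhs_wf (Terminal a) \<longleftrightarrow> True"
| "rhs_wf (Concat Bs) \<longleftrightarrow> length Bs > 1"
| "rhs_wf (Power B t) \<longleftrightarrow> t > 2"

fun rhs_size :: "'a rhs \<Rightarrow> nat" where
  "rhs_size (Terminal a) = 1"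
| "rhs_size (Concat Bs) = length Bs"
| "rhs_size (Power B t) = 2"

record 'a grammar =
  rules :: "nat \<rightharpoonup> 'a rhs"
  start :: nat

text \<open>The injective ranking \<open>ord\<close> is the required ordering of the variables.\<close>

definition rlslp :: "'a grammar \<Rightarrow> bool" where
  "rlslp G \<longleftrightarrow>
     finite (dom (rules G)) \<and>
     start G \<in> dom (rules G) \<and>
     (\<forall>A r. rules G A = Some r \<longrightarrow> rhs_wf r \<and> rhs_vars r \<subseteq> dom (rules G)) \<and>
     (\<exists>ord :: nat \<Rightarrow> nat. inj_on ord (dom (rules G)) \<and>
        (\<forall>A r. rules G A = Some r \<longrightarrow> (\<forall>B \<in> rhs_vars r. ord B < ord A)))"

inductive derives :: "'a grammar \<Rightarrow> nat \<Rightarrow> 'a list \<Rightarrow> bool" for G where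
  terminal: "rules G A = Some (Terminal a) \<Longrightarrow> derives G A [a]"
| concat: "rules G A = Some (Concat Bs) \<Longrightarrow> list_all2 (derives G) Bs ss \<Longrightarrow>
    derives G A (concat ss)"
| power: "rules G A = Some (Power B t) \<Longrightarrow> derives G B s \<Longrightarrow>
    derives G A (concat (replicate t s))"

definition generates :: "'a grammar \<Rightarrow> 'a list \<Rightarrow> bool" where
  "generates G w \<longleftrightarrow> derives G (start G) w"

definition grammar_size :: "'a grammar \<Rightarrow> nat" where
  "grammar_size G = (\<Sum>A \<in> dom (rules G). rhs_size (the (rules G A)))"

text \<open>Meaningful for nonempty strings only: no RLSLP generates the empty string.\<close>

definition g_rl :: "'a list \<Rightarrow> nat" where
  "g_rl w = (LEAST g. \<exists>G. rlslp G \<and> generates G w \<and> grammar_size G = g)"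

text \<open>Positions of strings are 1-based.\<close>

definition at_pos :: "'a list \<Rightarrow> nat \<Rightarrow> 'a" where
  "at_pos w j = w ! (j - 1)"

definition psv :: "'a::linorder list \<Rightarrow> nat \<Rightarrow> nat" where
  "psv w i = Max ({j \<in> {1..length w}. j < i \<and> at_pos w j < at_pos w i} \<union> {0})"

definition nsv :: "'a::linorder list \<Rightarrow> nat \<Rightarrow> nat" where
  "nsv w i = Min ({j \<in> {1..length w}. j > i \<and> at_pos w j < at_pos w i} \<union> {length w + 1})"

definition psv' :: "'a::linorder list \<Rightarrow> nat \<Rightarrow> 'a \<Rightarrow> nat" where
  "psv' w i d = Max ({j \<in> {1..length w}. j < i \<and> at_pos w j < d} \<union> {0})"

definition nsv' :: "'a::linorder list \<Rightarrow> nat \<Rightarrow> 'a \<Rightarrow> nat" where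
  "nsv' w i d = Min ({j \<in> {1..length w}. j > i \<and> at_pos w j < d} \<union> {length w + 1})"

text \<open>
  A word RAM with words of \<open>b\<close> bits. A cell holds either a word, i.e. a number below \<open>2 ^ b\<close>, or one
  symbol of the alphabet; symbols can be copied and compared, nothing else. The index is a read-only
  array \<open>M\<close> of cells, so no query can damage it. A query has its own working cells, which are
  addressed directly by the numbers in the instructions and indirectly by \<open>Fetch\<close> and \<open>Store\<close>.
  Every instruction costs one unit of time.
\<close>

datatype 'a cell = Word nat | Sym 'a

datatype arith_op = Add | Sub | Mul | Div | Mod

datatype instr =
    Const nat nat
  | Move nat nat
  | Arith arith_op nat nat nat
  | Read nat nat
  | Fetch nat nat
  | Store nat nat
  | Jump nat
  | JumpLess nat nat nat
  | Halt

text \<open>Arithmetic is modulo \<open>2 ^ b\<close>; the quotient by \<open>0\<close> is \<open>0\<close>.\<close>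

fun word_op :: "nat \<Rightarrow> arith_op \<Rightarrow> nat \<Rightarrow> nat \<Rightarrow> nat" where
  "word_op b Add x y = (x + y) mod 2 ^ b"
| "word_op b Sub x y = (2 ^ b + x - y) mod 2 ^ b"
| "word_op b Mul x y = (x * y) mod 2 ^ b"
| "word_op b Div x y = x div y"
| "word_op b Mod x y = x mod y"

fun cell_less :: "'a::linorder cell \<Rightarrow> 'a cell \<Rightarrow> bool option" where
  "cell_less (Word x) (Word y) = Some (x < y)"
| "cell_less (Sym x) (Sym y) = Some (x < y)"
| "cell_less _ _ = None"

type_synonym 'a config = "nat \<times> (nat \<Rightarrow> 'a cell)"

text \<open>
  A configuration is a program counter with the contents of the working cells. Destinations come
  first in the operands; \<open>None\<close> is a fault (ill-typed operands or a read outside the index).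
\<close>

fun step :: "nat \<Rightarrow> 'a::linorder cell list \<Rightarrow> instr \<Rightarrow> 'a config \<Rightarrow> 'a config option" where
  "step b M (Const r k) (pc, R) = Some (pc + 1, R(r := Word (k mod 2 ^ b)))"
| "step b M (Move r s) (pc, R) = Some (pc + 1, R(r := R s))"
| "step b M (Arith f r s t) (pc, R) =
     (case (R s, R t) of
        (Word x, Word y) \<Rightarrow> Some (pc + 1, R(r := Word (word_op b f x y)))
      | _ \<Rightarrow> None)"
| "step b M (Read r s) (pc, R) =
     (case R s of
        Word x \<Rightarrow> if x < length M then Some (pc + 1, R(r := M ! x)) else None
      | Sym _ \<Rightarrow> None)"
| "step b M (Fetch r s) (pc, R) =
     (case R s of Word x \<Rightarrow> Some (pc + 1, R(r := R x)) | Sym _ \<Rightarrow> None)"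
| "step b M (Store r s) (pc, R) =
     (case R r of Word x \<Rightarrow> Some (pc + 1, R(x := R s)) | Sym _ \<Rightarrow> None)"
| "step b M (Jump l) (pc, R) = Some (l, R)"
| "step b M (JumpLess r s l) (pc, R) =
     (case cell_less (R r) (R s) of
        Some c \<Rightarrow> Some (if c then l else pc + 1, R)
      | None \<Rightarrow> None)"
| "step b M Halt (pc, R) = None"

text \<open>
  \<open>exec b M P t c = Some v\<close> iff the program \<open>P\<close>, run from configuration \<open>c\<close> on the index \<open>M\<close>, executes
  \<open>Halt\<close> after at most \<open>t\<close> instructions (\<open>Halt\<close> included) with \<open>v\<close> in working cell 0.
\<close>

fun exec :: "nat \<Rightarrow> 'a::linorder cell list \<Rightarrow> instr list \<Rightarrow> nat \<Rightarrow> 'a config \<Rightarrow> 'a cell option" where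
  "exec b M P 0 c = None"
| "exec b M P (Suc t) (pc, R) =
     (if pc \<ge> length P then None
      else if P ! pc = Halt then Some (R 0)
      else case step b M (P ! pc) (pc, R) of
             Some c' \<Rightarrow> exec b M P t c'
           | None \<Rightarrow> None)"

text \<open>Initially the first working cells hold the query arguments and all others the word 0.\<close>

fun load :: "'a cell list \<Rightarrow> nat \<Rightarrow> 'a cell" where
  "load args r = (if r < length args then args ! r else Word 0)"

definition answers ::
  "nat \<Rightarrow> 'a::linorder cell list \<Rightarrow> instr list \<Rightarrow> nat \<Rightarrow> 'a cell list \<Rightarrow> nat \<Rightarrow> bool" where
  "answers b M P t args v \<longleftrightarrow> exec b M P t (0, load args) = Some (Word v)"

fun cell_fits :: "nat \<Rightarrow> 'a cell \<Rightarrow> bool" where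
  "cell_fits b (Word x) \<longleftrightarrow> x < 2 ^ b"
| "cell_fits b (Sym a) \<longleftrightarrow> True"

text \<open>
  Word length as a function of the string length: logarithmic, and such that the query arguments and
  answers \<open>0, \<dots>, n + 1\<close> are words.
\<close>

definition word_length :: "(nat \<Rightarrow> nat) \<Rightarrow> bool" where
  "word_length b \<longleftrightarrow>
     (\<lambda>n. real (b n)) \<in> \<Theta>(\<lambda>n. log 2 (real n)) \<and> (\<forall>n. n + 1 < 2 ^ b n)"

end

theory Submission
  imports Defs "HOL-Library.Discrete_Functions"
begin

text \<open>
  The variables of a program are represented by the expressions they unfold to, so a program is the
  set of subexpressions of one expression. Consider the edges of this DAG along which neither the
  length nor the number of occurrences in the parse tree changes its binary order of magnitude. They
  form disjoint paths, never enter the base of a power, and every walk from the root to a leaf uses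
  only \<open>O(log n)\<close> other edges. On each path put a search tree that is biased both by the lengths of
  the children hanging off the path and by the numbers of occurrences with which the path is entered
  from outside. The costs of passing through the paths then telescope, in the lengths downwards and
  in the occurrences upwards, so replacing the paths by the trees yields an equivalent expression of
  height \<open>O(log n)\<close> with \<open>O(g\<^sub>r\<^sub>l)\<close> subexpressions.

  The index stores the least symbol and the length of every subexpression. A query for the previous
  smaller value descends towards its position and remembers the last node left behind on the left
  whose least symbol is small enough. If the search fails it restarts at that node, where it must
  succeed. Next smaller values are previous smaller values of the reversed string.
\<close>

text \<open>A path can be entered at each of its nodes, so every suffix of it needs an expression of
  its own. Separate trees for the suffixes would cost a logarithmic factor in size; instead the
  trees for the blocks of one recursive bisection are shared by all suffixes, with at most eight new
  expressions per node. A walk that enters a path at \<open>v\<close> and leaves it towards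
  \<open>off u\<close> pays 3 per level of the bisection for cutting off what precedes
  \<open>v\<close>, and 2 per level for reaching \<open>u\<close>. On a path with lengths about
  \<open>2 ^ k\<close> and occurrences about \<open>2 ^ c\<close>, the weights make this roughly
  \<open>3 * (c - floor_log (entry v))\<close> and \<open>2 * (k - lglen (off u))\<close>. Since
  \<open>off u\<close> is entered at least \<open>2 ^ c\<close> times from outside its own path,
  both sums telescope over the walk. Only a constant per path remains, and it is charged to the drop
  of \<open>level\<close>.\<close>

datatype 'a expr = Emp | Chr 'a | Cat "'a expr" "'a expr" | Rep "'a expr" nat

primrec yield :: "'a expr \<Rightarrow> 'a list" where
  "yield Emp = []"
| "yield (Chr a) = [a]"
| "yield (Cat x y) = yield x @ yield y"
| "yield (Rep x t) = concat (replicate t (yield x))"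

primrec subs :: "'a expr \<Rightarrow> 'a expr set" where
  "subs Emp = {Emp}"
| "subs (Chr a) = {Chr a}"
| "subs (Cat x y) = insert (Cat x y) (subs x \<union> subs y)"
| "subs (Rep x t) = insert (Rep x t) (subs x)"

primrec height :: "'a expr \<Rightarrow> nat" where
  "height Emp = 0"
| "height (Chr a) = 0"
| "height (Cat x y) = Suc (max (height x) (height y))"
| "height (Rep x t) = Suc (height x)"

primrec ok :: "'a expr \<Rightarrow> bool" where
  "ok Emp = False"
| "ok (Chr a) = True"
| "ok (Cat x y) = (ok x \<and> ok y)"
| "ok (Rep x t) = (ok x \<and> t \<ge> 2)"

abbreviation len :: "'a expr \<Rightarrow> nat" where
  "len x \<equiv> length (yield x)"

lemma finite_subs [simp]: "finite (subs x)"
  by (induction x) auto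

lemma self_subs [simp]: "x \<in> subs x"
  by (cases x) auto

lemma subs_trans: "x \<in> subs y \<Longrightarrow> y \<in> subs z \<Longrightarrow> x \<in> subs z"
  by (induction z) auto

lemma len_Rep [simp]: "length (concat (replicate t ys)) = t * length ys"
  by (induction t) auto

lemma ok_subs: "ok y \<Longrightarrow> x \<in> subs y \<Longrightarrow> ok x"
  by (induction y) auto

lemma len_pos: "ok x \<Longrightarrow> 0 < len x"
  by (induction x) auto

subsection \<open>Biased binary trees over weighted lists\<close>

text \<open>What hangs to the left of a path is read downwards; what hangs to the right is read
  upwards, hence the reversal in \<open>cat_r\<close>.\<close>

definition cat_l :: "('v \<Rightarrow> 'a expr) \<Rightarrow> 'v list \<Rightarrow> 'a list" where
  "cat_l L vs = concat (map (\<lambda>v. yield (L v)) vs)"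

definition cat_r :: "('v \<Rightarrow> 'a expr) \<Rightarrow> 'v list \<Rightarrow> 'a list" where
  "cat_r R vs = concat (map (\<lambda>v. yield (R v)) (rev vs))"

lemma cat_l_simps [simp]:
  "cat_l L [] = []" "cat_l L (v # vs) = yield (L v) @ cat_l L vs"
  "cat_l L (vs @ ws) = cat_l L vs @ cat_l L ws"
  by (auto simp: cat_l_def)

lemma cat_r_simps [simp]:
  "cat_r R [] = []" "cat_r R (v # vs) = cat_r R vs @ yield (R v)"
  "cat_r R (vs @ ws) = cat_r R ws @ cat_r R vs"
  by (auto simp: cat_r_def)

abbreviation suffix_from :: "'v \<Rightarrow> 'v list \<Rightarrow> 'v list" where
  "suffix_from v vs \<equiv> dropWhile (\<lambda>u. u \<noteq> v) vs"

text \<open>With \<open>c\<close> half of the total weight, \<open>x\<close> is a weighted median: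
  what lies on either side of it weighs at most half.\<close>

lemma weighted_split:
  fixes p :: "'v \<Rightarrow> nat"
  assumes "c < sum_list (map p vs)"
  shows "\<exists>l x r. vs = l @ x # r \<and> sum_list (map p l) \<le> c \<and> c < sum_list (map p l) + p x"
  using assms
proof (induction vs arbitrary: c)
  case (Cons v vs)
  show ?case
  proof (cases "c < p v")
    case True
    then show ?thesis by (intro exI[of _ "[]"]) auto
  next
    case False
    with Cons.prems have "c - p v < sum_list (map p vs)" by auto
    from Cons.IH[OF this] obtain l x r where
      "vs = l @ x # r" "sum_list (map p l) \<le> c - p v" "c - p v < sum_list (map p l) + p x"
      by blast
    with False show ?thesis by (intro exI[of _ "v # l"] exI[of _ x] exI[of _ r]) auto
  qed
qed simp

locale biased_contexts =
  fixes p :: "'v \<Rightarrow> nat" and L R :: "'v \<Rightarrow> 'a expr"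
begin

text \<open>An element of weight \<open>p v\<close> lies at depth at most about \<open>K - log p v\<close> in a biased tree of total
  weight below \<open>2 ^ K\<close>, and each level of the tree costs two nested \<open>Cat\<close>.\<close>

definition fits :: "nat \<Rightarrow> 'v list \<Rightarrow> nat \<Rightarrow> bool" where
  "fits K vs H \<longleftrightarrow> (\<forall>v\<in>set vs. height (L v) + 2 * (K - floor_log (p v)) \<le> H \<and>
                               height (R v) + 2 * (K - floor_log (p v)) \<le> H)"

text \<open>New subterms are charged to the list elements, by means of \<open>N\<close>.\<close>

definition charged :: "('v \<Rightarrow> 'a expr set) \<Rightarrow> 'v list \<Rightarrow> 'a expr set" where
  "charged N vs = insert Emp (\<Union>v\<in>set vs. N v \<union> subs (L v) \<union> subs (R v))"

definition small :: "nat \<Rightarrow> ('v \<Rightarrow> 'a expr set) \<Rightarrow> bool" where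
  "small c N \<longleftrightarrow> (\<forall>v. finite (N v) \<and> card (N v) \<le> c)"

text \<open>The height bound ranges over all \<open>H\<close> because the recursive calls on the two
  sides of the median are used with \<open>H - 2\<close>.\<close>

definition tree :: "nat \<Rightarrow> 'v list \<Rightarrow> 'a expr \<Rightarrow> 'a expr \<Rightarrow> ('v \<Rightarrow> 'a expr set) \<Rightarrow> bool" where
  "tree K vs TL TR N \<longleftrightarrow>
     yield TL = cat_l L vs \<and> yield TR = cat_r R vs \<and> small 4 N \<and>
     subs TL \<union> subs TR \<subseteq> charged N vs \<and>
     (\<forall>H. fits K vs H \<longrightarrow> height TL \<le> H \<and> height TR \<le> H)"

text \<open>\<open>rest\<close> stands for all that lies below the list, so \<open>S v\<close>
  replaces a path entered at \<open>v\<close>. In the height, 3 per level pays for cutting off the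
  elements before \<open>v\<close>.\<close>

definition wraps :: "nat \<Rightarrow> 'v list \<Rightarrow> 'a expr \<Rightarrow> ('v \<Rightarrow> 'a expr) \<Rightarrow> ('v \<Rightarrow> 'a expr set) \<Rightarrow> bool" where
  "wraps K vs rest S N \<longleftrightarrow> (\<forall>v\<in>set vs.
     yield (S v) = cat_l L (suffix_from v vs) @ yield rest @ cat_r R (suffix_from v vs) \<and>
     subs (S v) \<subseteq> charged N vs \<union> subs rest \<and>
     (\<forall>H. fits K vs H \<longrightarrow> height (S v) \<le> 3 * (K - floor_log (p v)) + max H (height rest)))"

text \<open>One binary order of weight less frees two levels of height; the bound on
  \<open>floor_log (p v)\<close> ensures that the subtraction is not truncated.\<close>

lemma fits_step:
  assumes "fits (Suc k) (l @ x # r) H" "\<forall>v\<in>set (l @ x # r). floor_log (p v) \<le> k"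
  shows "fits k l (H - 2)" "fits k r (H - 2)" "height (L x) + 2 \<le> H" "height (R x) + 2 \<le> H"
proof -
  have *: "height (L v) + 2 * (k - floor_log (p v)) + 2 \<le> H"
          "height (R v) + 2 * (k - floor_log (p v)) + 2 \<le> H" if "v \<in> set (l @ x # r)" for v
    using assms(1)[unfolded fits_def, rule_format, OF that] assms(2)[rule_format, OF that]
    by (auto simp: Suc_diff_le)
  show "fits k l (H - 2)" "fits k r (H - 2)"
    using * unfolding fits_def by (force intro: add_le_imp_le_diff)+
  show "height (L x) + 2 \<le> H" "height (R x) + 2 \<le> H"
    using *[of x] by auto
qed

lemma charged_mono:
  "set ws \<subseteq> set vs \<Longrightarrow> (\<And>v. v \<in> set ws \<Longrightarrow> N v \<subseteq> N' v) \<Longrightarrow> charged N ws \<subseteq> charged N' vs"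
  unfolding charged_def by blast

text \<open>The median and the trees of both sides need two nested \<open>Cat\<close>, whence the 2
  in \<open>fits\<close>. On the right the order is reversed, so there \<open>x\<close> is joined to
  the tree of \<open>l\<close>.\<close>

lemma tree_step:
  assumes l: "tree k l TLl TRl Nl" and r: "tree k r TLr TRr Nr"
    and dist: "distinct (l @ x # r)" and fl: "\<forall>v\<in>set (l @ x # r). floor_log (p v) \<le> k"
  defines "A \<equiv> Cat (L x) TLr" and "B \<equiv> Cat (R x) TRl"
  shows "tree (Suc k) (l @ x # r) (Cat TLl A) (Cat TRr B)
    (\<lambda>v. if v = x then {A, B, Cat TLl A, Cat TRr B} else if v \<in> set l then Nl v else Nr v)"
    (is "tree _ ?vs _ _ ?N")
proof -
  have "card {A, B, Cat TLl A, Cat TRr B} \<le> 4"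
    by (auto simp: card_insert_if)
  then have "small 4 ?N"
    using l r by (auto simp: tree_def small_def)
  moreover have "charged Nl l \<subseteq> charged ?N ?vs"
    by (rule charged_mono) (use dist in auto)
  moreover have "charged Nr r \<subseteq> charged ?N ?vs"
    by (rule charged_mono) (use dist in auto)
  moreover have "{A, B, Cat TLl A, Cat TRr B} \<union> subs (L x) \<union> subs (R x) \<subseteq> charged ?N ?vs"
    by (auto simp: charged_def)
  moreover have "height (Cat TLl A) \<le> H \<and> height (Cat TRr B) \<le> H" if "fits (Suc k) ?vs H" for H
  proof -
    note s = fits_step[OF that fl]
    have "height TLl \<le> H - 2 \<and> height TRl \<le> H - 2" "height TLr \<le> H - 2 \<and> height TRr \<le> H - 2"
      using l r s(1,2) by (auto simp: tree_def)
    with s(3,4) show ?thesis by (auto simp: A_def B_def)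
  qed
  ultimately show ?thesis
    using l r unfolding tree_def by (auto simp: A_def B_def)
qed

text \<open>Suffixes that start in \<open>r\<close> do not see \<open>x\<close>. The suffix at
  \<open>x\<close> wraps the trees of \<open>r\<close> around \<open>rest\<close>, and this becomes
  the \<open>rest\<close> for suffixes that start in \<open>l\<close>. In it \<open>rest\<close> has
  depth 2, and no tree of \<open>r\<close> lies deeper than 3: this is the 3 per level.\<close>

lemma wraps_step:
  assumes l: "wraps k l (Cat (Cat (L x) TLr) (Cat rest (Cat TRr (R x)))) Sl Nl"
    and r: "wraps k r rest Sr Nr" and t: "tree k r TLr TRr N0"
    and dist: "distinct (l @ x # r)" and fl: "\<forall>v\<in>set (l @ x # r). floor_log (p v) \<le> k"
    and N: "\<And>v. v \<in> set l \<Longrightarrow> Nl v \<subseteq> N v" "\<And>v. v \<in> set r \<Longrightarrow> Nr v \<union> N0 v \<subseteq> N v"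
      "{Cat (Cat (L x) TLr) (Cat rest (Cat TRr (R x))), Cat (L x) TLr,
        Cat rest (Cat TRr (R x)), Cat TRr (R x)} \<subseteq> N x"
  shows "wraps (Suc k) (l @ x # r) rest
    (\<lambda>v. if v = x then Cat (Cat (L x) TLr) (Cat rest (Cat TRr (R x)))
         else if v \<in> set l then Sl v else Sr v) N"
    (is "wraps _ ?vs _ ?S _")
  unfolding wraps_def
proof
  fix v assume v: "v \<in> set ?vs"
  let ?X = "Cat (Cat (L x) TLr) (Cat rest (Cat TRr (R x)))"
  have Nl: "charged Nl l \<subseteq> charged N ?vs" and Nr: "charged Nr r \<subseteq> charged N ?vs"
    and N0: "charged N0 r \<subseteq> charged N ?vs"
    by (rule charged_mono; use N in auto)+
  have "{?X, Cat (L x) TLr, Cat rest (Cat TRr (R x)), Cat TRr (R x)} \<union> subs (L x) \<union> subs (R x)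
      \<subseteq> charged N ?vs"
    using N(3) unfolding charged_def by auto
  with N0 t have X: "subs ?X \<subseteq> charged N ?vs \<union> subs rest"
    unfolding tree_def by auto
  have hX: "height ?X \<le> 3 + max (H - 2) (height rest)" if "fits (Suc k) ?vs H" for H
  proof -
    note s = fits_step[OF that fl]
    have "height TLr \<le> H - 2 \<and> height TRr \<le> H - 2"
      using t s(2) by (auto simp: tree_def)
    with s(3,4) show ?thesis by auto
  qed
  have flv: "floor_log (p v) \<le> k" using fl v by blast
  consider "v = x" | "v \<in> set l" "v \<noteq> x" | "v \<in> set r" "v \<notin> set l" "v \<noteq> x"
    using v by auto
  then show "yield (?S v) = cat_l L (suffix_from v ?vs) @ yield rest @ cat_r R (suffix_from v ?vs) \<and>
     subs (?S v) \<subseteq> charged N ?vs \<union> subs rest \<and>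
     (\<forall>H. fits (Suc k) ?vs H \<longrightarrow> height (?S v) \<le> 3 * (Suc k - floor_log (p v)) + max H (height rest))"
  proof cases
    case 1
    then have "suffix_from v ?vs = x # r"
      using dist by (subst dropWhile_append2) auto
    moreover have "height ?X \<le> 3 * (Suc k - floor_log (p v)) + max H (height rest)"
      if "fits (Suc k) ?vs H" for H
      using order_trans[OF hX[OF that], of "3 + max H (height rest)"]
      unfolding Suc_diff_le[OF flv] by (auto simp: max.coboundedI1 simp del: height.simps)
    ultimately show ?thesis using 1 X t by (auto simp: tree_def)
  next
    case 2
    have sf: "suffix_from v ?vs = suffix_from v l @ x # r"
      using 2 by (intro dropWhile_append1) auto
    have "height (Sl v) \<le> 3 * (Suc k - floor_log (p v)) + max H (height rest)"
      if H: "fits (Suc k) ?vs H" for H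
    proof -
      have "height (Sl v) \<le> 3 * (k - floor_log (p v)) + max (H - 2) (height ?X)"
        using l 2 fits_step(1)[OF H fl] by (auto simp: wraps_def)
      moreover have "max (H - 2) (height ?X) \<le> 3 + max H (height rest)"
        by (intro max.boundedI order_trans[OF hX[OF H]]) (auto simp: max_def)
      moreover have "a \<le> 3 * Suc d + h" if "a \<le> 3 * d + m" "m \<le> 3 + h" for a d m h :: nat
        using that by simp
      ultimately show ?thesis unfolding Suc_diff_le[OF flv] by blast
    qed
    moreover have "subs (Sl v) \<subseteq> charged N ?vs \<union> subs rest"
      using l 2 Nl X unfolding wraps_def by blast
    ultimately show ?thesis using 2 l sf t by (auto simp: wraps_def tree_def)
  next
    case 3
    have sf: "suffix_from v ?vs = suffix_from v r"
      using 3 by (subst dropWhile_append2) auto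
    have "height (Sr v) \<le> 3 * (Suc k - floor_log (p v)) + max H (height rest)"
      if H: "fits (Suc k) ?vs H" for H
    proof -
      have "height (Sr v) \<le> 3 * (k - floor_log (p v)) + max (H - 2) (height rest)"
        using r 3 fits_step(2)[OF H fl] by (auto simp: wraps_def)
      then show ?thesis unfolding Suc_diff_le[OF flv]
        by (rule order_trans) (intro add_mono max.mono; simp)
    qed
    moreover have "subs (Sr v) \<subseteq> charged N ?vs \<union> subs rest"
      using r 3 Nr unfolding wraps_def by blast
    ultimately show ?thesis using 3 r sf by (auto simp: wraps_def)
  qed
qed

text \<open>The trees are fixed before \<open>rest\<close>. In the recursion \<open>l\<close> is
  wrapped around an expression built from the trees of \<open>r\<close>, and these have to be the
  trees that also occur in the tree of the whole list, or their nodes would be charged anew at every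
  level. Each element pays for four expressions in the trees and four in the wraps.\<close>

lemma biased_tree:
  assumes "distinct vs" "\<forall>v\<in>set vs. 0 < p v" "sum_list (map p vs) < 2 ^ K"
  shows "\<exists>TL TR N. tree K vs TL TR N \<and>
    (\<forall>rest. \<exists>S N'. small 4 N' \<and> wraps K vs rest S (\<lambda>v. N v \<union> N' v))"
  using assms
proof (induction vs arbitrary: K rule: length_induct)
  case (1 vs)
  show ?case
  proof (cases "vs = []")
    case True
    then show ?thesis
      by (intro exI[of _ Emp] exI[of _ "\<lambda>_. {}"])
        (auto simp: tree_def wraps_def small_def charged_def)
  next
    case False
    define P where "P = sum_list (map p vs)"
    from False 1(3) have P0: "0 < P"
      by (cases vs) (auto simp: P_def)
    have "P div 2 < sum_list (map p vs)" using P0 by (simp add: P_def)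
    from weighted_split[OF this] obtain l x r where vs: "vs = l @ x # r"
      and l: "sum_list (map p l) \<le> P div 2" and lx: "P div 2 < sum_list (map p l) + p x"
      by blast
    have Psum: "P = sum_list (map p l) + p x + sum_list (map p r)" by (simp add: P_def vs)
    obtain k where K: "K = Suc k"
      using P0 1(4) unfolding P_def[symmetric] by (cases K) auto
    have lk: "sum_list (map p l) < 2 ^ k" and rk: "sum_list (map p r) < 2 ^ k"
      using l lx Psum 1(4) by (auto simp: K P_def[symmetric])
    have fl: "floor_log (p v) \<le> k" if "v \<in> set vs" for v
    proof -
      have "p v \<le> P" unfolding P_def using that by (auto simp: member_le_sum_list)
      moreover have "2 ^ floor_log (p v) \<le> p v"
        using 1(3) that by (intro floor_log_exp2_le) auto
      ultimately have "(2::nat) ^ floor_log (p v) < 2 ^ Suc k"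
        using 1(4) by (simp add: K P_def[symmetric])
      then show ?thesis by (simp add: less_Suc_eq_le[symmetric] del: power_Suc)
    qed
    have dist: "distinct (l @ x # r)"
      using 1(2) by (simp add: vs)
    have "length l < length vs" "distinct l" "\<forall>v\<in>set l. 0 < p v"
      using dist 1(3) by (auto simp: vs)
    with 1(1) lk obtain TLl TRl Nl where l1: "tree k l TLl TRl Nl"
      and l2: "\<And>rest. \<exists>S N'. small 4 N' \<and> wraps k l rest S (\<lambda>v. Nl v \<union> N' v)"
      by blast
    have "length r < length vs" "distinct r" "\<forall>v\<in>set r. 0 < p v"
      using dist 1(3) by (auto simp: vs)
    with 1(1) rk obtain TLr TRr Nr where r1: "tree k r TLr TRr Nr"
      and r2: "\<And>rest. \<exists>S N'. small 4 N' \<and> wraps k r rest S (\<lambda>v. Nr v \<union> N' v)"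
      by blast
    define A where "A = Cat (L x) TLr"
    define B where "B = Cat (R x) TRl"
    define N where "N = (\<lambda>v. if v = x then {A, B, Cat TLl A, Cat TRr B}
      else if v \<in> set l then Nl v else Nr v)"
    have "\<exists>S N'. small 4 N' \<and> wraps K vs rest S (\<lambda>v. N v \<union> N' v)" for rest
    proof -
      define C where "C = Cat TRr (R x)"
      define X where "X = Cat (Cat (L x) TLr) (Cat rest C)"
      obtain Sl Nl' where l3: "small 4 Nl'" "wraps k l X Sl (\<lambda>v. Nl v \<union> Nl' v)"
        using l2 by blast
      obtain Sr Nr' where r3: "small 4 Nr'" "wraps k r rest Sr (\<lambda>v. Nr v \<union> Nr' v)"
        using r2 by blast
      define N' where "N' = (\<lambda>v. if v = x then {X, A, Cat rest C, C}
        else if v \<in> set l then Nl' v else Nr' v)"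
      have "wraps (Suc k) (l @ x # r) rest (\<lambda>v. if v = x then X else if v \<in> set l then Sl v else Sr v)
        (\<lambda>v. N v \<union> N' v)"
        unfolding X_def C_def
        by (rule wraps_step[OF l3(2)[unfolded X_def C_def] r3(2) r1 dist])
          (use fl dist in \<open>auto simp: N_def N'_def vs A_def X_def C_def\<close>)
      moreover have "card {X, A, Cat rest C, C} \<le> 4"
        by (auto simp: card_insert_if)
      then have "small 4 N'"
        using l3(1) r3(1) by (auto simp: small_def N'_def)
      ultimately show ?thesis by (auto simp: K vs)
    qed
    moreover have "tree K vs (Cat TLl A) (Cat TRr B) N"
      using tree_step[OF l1 r1 dist] fl unfolding K vs A_def B_def N_def by blast
    ultimately show ?thesis by blast
  qed
qed

lemma biased_wrap:
  assumes "distinct vs" "\<forall>v\<in>set vs. 0 < p v" "sum_list (map p vs) < 2 ^ K"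
  shows "\<exists>S N. small 8 N \<and> wraps K vs rest S N"
proof -
  obtain TL TR N S N' where *: "tree K vs TL TR N" "small 4 N'" "wraps K vs rest S (\<lambda>v. N v \<union> N' v)"
    using biased_tree[OF assms] by blast
  have "card (N v \<union> N' v) \<le> 8" for v
  proof -
    have "card (N v) \<le> 4" "card (N' v) \<le> 4"
      using *(1,2) by (auto simp: tree_def small_def)
    with card_Un_le[of "N v" "N' v"] show ?thesis by linarith
  qed
  then have "small 8 (\<lambda>v. N v \<union> N' v)"
    using * by (auto simp: small_def tree_def)
  with * show ?thesis by blast
qed

end

subsection \<open>Symmetric centroid paths\<close>

primrec occ :: "'a expr \<Rightarrow> 'a expr \<Rightarrow> nat" where
  "occ x Emp = (if x = Emp then 1 else 0)"
| "occ x (Chr a) = (if x = Chr a then 1 else 0)"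
| "occ x (Cat y z) = (if x = Cat y z then 1 else 0) + occ x y + occ x z"
| "occ x (Rep y t) = (if x = Rep y t then 1 else 0) + t * occ x y"

fun mult :: "'a expr \<Rightarrow> 'a expr \<Rightarrow> nat" where
  "mult (Cat y z) x = (if y = x then 1 else 0) + (if z = x then 1 else 0)"
| "mult (Rep y t) x = (if y = x then t else 0)"
| "mult _ x = 0"

lemma sum_if_eq: "finite Y \<Longrightarrow> e \<in> Y \<Longrightarrow> (\<Sum>y\<in>Y. g y * (if y = e then 1 else 0)) = (g e :: nat)"
  by (simp add: if_distrib cong: if_cong)

text \<open>Every occurrence except the root hangs below one occurrence of a parent.
  \<open>Y\<close> may exceed \<open>subs e\<close>, so the induction can keep it fixed for the
  children.\<close>

lemma occ_parents:
  "finite Y \<Longrightarrow> subs e \<subseteq> Y \<Longrightarrow>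
    occ x e = (if x = e then 1 else 0) + (\<Sum>y\<in>Y. mult y x * occ y e)"
proof (induction e)
  case Emp
  have "(\<Sum>y\<in>Y. mult y x * occ y Emp) = mult Emp x" using Emp by (simp add: sum_if_eq)
  then show ?case by simp
next
  case (Chr a)
  have "(\<Sum>y\<in>Y. mult y x * occ y (Chr a)) = mult (Chr a) x" using Chr by (simp add: sum_if_eq)
  then show ?case by simp
next
  case (Cat a b)
  have "(\<Sum>y\<in>Y. mult y x * occ y (Cat a b)) = mult (Cat a b) x
    + (\<Sum>y\<in>Y. mult y x * occ y a) + (\<Sum>y\<in>Y. mult y x * occ y b)"
    using Cat.prems sum_if_eq[of Y "Cat a b" "\<lambda>y. mult y x"]
    by (simp add: distrib_left sum.distrib)
  then show ?case using Cat by (auto simp del: mult.simps simp add: mult.simps(1))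
next
  case (Rep a t)
  have "(\<Sum>y\<in>Y. mult y x * occ y (Rep a t)) = mult (Rep a t) x
    + t * (\<Sum>y\<in>Y. mult y x * occ y a)"
    using Rep.prems sum_if_eq[of Y "Rep a t" "\<lambda>y. mult y x"]
    by (simp add: distrib_left sum.distrib sum_distrib_left mult.left_commute)
  then show ?case using Rep by (auto simp: algebra_simps)
qed

lemma size_subs: "x \<in> subs y \<Longrightarrow> size x \<le> size y"
  by (induction y) auto

lemma size_mult: "0 < mult y x \<Longrightarrow> size x < size y"
  by (cases y) (auto split: if_splits)

lemma mult_subs: "0 < mult y x \<Longrightarrow> x \<in> subs y"
  by (cases y) (auto split: if_splits)

lemma occ_zero: "x \<notin> subs e \<Longrightarrow> occ x e = 0"
  by (induction e) auto

lemma occ_pos: "ok e \<Longrightarrow> x \<in> subs e \<Longrightarrow> 0 < occ x e"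
  by (induction e) auto

lemma occ_smaller: "size e < size x \<Longrightarrow> occ x e = 0"
  using size_subs[of x e] by (intro occ_zero) auto

lemma occ_self: "occ e e = 1"
  by (cases e) (auto simp: occ_smaller)

text \<open>Occurrences of the same expression never nest, so they cover disjoint blocks of the
  yield.\<close>

lemma len_occ: "len x * occ x e \<le> len e"
proof (induction e)
  case (Cat a b)
  then show ?case
    by (cases "x = Cat a b") (auto simp: occ_smaller distrib_left intro: add_mono)
next
  case (Rep a t)
  then show ?case
    by (cases "x = Rep a t") (auto simp: occ_smaller mult.left_commute)
qed auto

locale centroid =
  fixes r :: "'a expr"
  assumes ok_r: "ok r"
begin

abbreviation "V \<equiv> subs r"

abbreviation lglen :: "'a expr \<Rightarrow> nat" where "lglen x \<equiv> floor_log (len x)"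
abbreviation lgocc :: "'a expr \<Rightarrow> nat" where "lgocc x \<equiv> floor_log (occ x r)"

definition sc :: "'a expr \<Rightarrow> 'a expr \<Rightarrow> bool" where
  "sc y x \<longleftrightarrow> 0 < mult y x \<and> lglen x = lglen y \<and> lgocc x = lgocc y"

text \<open>A potential: neither summand increases along an edge, and an edge off the paths lowers
  at least one. By \<open>lgocc_le\<close> the subtraction is not truncated.\<close>

definition level :: "'a expr \<Rightarrow> nat" where
  "level x = lglen x + (lglen r - lgocc x)"

text \<open>The occurrences of \<open>x\<close> that are not entered along its path.\<close>

definition entry :: "'a expr \<Rightarrow> nat" where
  "entry x = occ x r - (\<Sum>y\<in>{y\<in>V. sc y x}. occ y r)"

lemma V_ok: "x \<in> V \<Longrightarrow> ok x"
  using ok_r ok_subs by blast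

lemma V_len: "x \<in> V \<Longrightarrow> 0 < len x"
  using V_ok len_pos by blast

lemma V_occ: "x \<in> V \<Longrightarrow> 0 < occ x r"
  using ok_r occ_pos by blast

lemma child_V: "y \<in> V \<Longrightarrow> 0 < mult y x \<Longrightarrow> x \<in> V"
  using mult_subs subs_trans by blast

lemma lgocc_le: "x \<in> V \<Longrightarrow> lgocc x \<le> lglen r"
proof (intro floor_log_le_iff)
  assume "x \<in> V"
  then have "1 * occ x r \<le> len x * occ x r" using V_len[of x] by (intro mult_right_mono) (simp_all add: Suc_le_eq)
  also have "\<dots> \<le> len r" by (rule len_occ)
  finally show "occ x r \<le> len r" by simp
qed

lemma child_len: "y \<in> V \<Longrightarrow> 0 < mult y x \<Longrightarrow> len x \<le> len y"
  using V_ok[of y] by (cases y) (auto split: if_splits)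

lemma parents_occ:
  assumes "Y \<subseteq> V" "\<forall>y\<in>Y. 0 < mult y x"
  shows "(\<Sum>y\<in>Y. occ y r) \<le> occ x r"
proof -
  have "(\<Sum>y\<in>Y. occ y r) \<le> (\<Sum>y\<in>Y. mult y x * occ y r)"
    using assms(2) by (intro sum_mono) auto
  also have "\<dots> \<le> (\<Sum>y\<in>V. mult y x * occ y r)"
    using assms(1) by (intro sum_mono2) auto
  also have "\<dots> \<le> occ x r"
    by (subst occ_parents[of V]) auto
  finally show ?thesis .
qed

lemma child_occ: "y \<in> V \<Longrightarrow> 0 < mult y x \<Longrightarrow> occ y r \<le> occ x r"
  using parents_occ[of "{y}" x] by simp

text \<open>Two such parents would bring at least \<open>2 ^ lgocc x\<close> occurrences each and so
  lift \<open>occ x r\<close> to the next power of two.\<close>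

lemma sc_unique_parent:
  assumes "y \<in> V" "y' \<in> V" "sc y x" "sc y' x"
  shows "y = y'"
proof (rule ccontr)
  assume "y \<noteq> y'"
  then have "occ y r + occ y' r \<le> occ x r"
    using parents_occ[of "{y, y'}" x] assms by (auto simp: sc_def)
  moreover have "2 ^ lgocc x \<le> occ z r" if "z \<in> V" "sc z x" for z
    using floor_log_exp2_le[OF V_occ[OF that(1)]] that(2) by (simp add: sc_def)
  then have "2 ^ lgocc x \<le> occ y r" "2 ^ lgocc x \<le> occ y' r"
    using assms by blast+
  ultimately show False using floor_log_exp2_gt[of "occ x r"] by simp
qed

lemma sc_no_double:
  assumes "x \<in> V" "lglen x = lglen y"
  shows "\<not> 2 * len x \<le> len y"
proof
  assume "2 * len x \<le> len y"
  moreover have "2 ^ lglen x \<le> len x" using assms V_len by (intro floor_log_exp2_le) auto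
  ultimately show False using floor_log_exp2_gt[of "len y"] assms(2) by simp
qed

text \<open>A power, or a concatenation of \<open>x\<close> with itself, at least doubles the
  length; and two children cannot both be longer than half of their parent.\<close>

lemma sc_Cat:
  assumes "y \<in> V" "sc y x"
  obtains z where "y = Cat x z \<or> y = Cat z x" "z \<noteq> x" "0 < mult y z" "\<not> sc y z" "len y = len x + len z"
proof -
  have x: "x \<in> V" using assms child_V by (auto simp: sc_def)
  have nd: "\<not> 2 * len x \<le> len y" using assms x sc_no_double by (auto simp: sc_def)
  show ?thesis
  proof (cases y)
    case (Rep a t)
    with assms nd V_ok[of y] show ?thesis by (auto simp: sc_def split: if_splits)
  next
    case (Cat a b)
    obtain z where z: "y = Cat x z \<or> y = Cat z x"
      using assms Cat by (auto simp: sc_def split: if_splits)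
    then have l: "len y = len x + len z" and m: "0 < mult y z" by auto
    have "\<not> sc y z"
    proof
      assume "sc y z"
      moreover from this have "z \<in> V" using assms child_V by (auto simp: sc_def)
      ultimately have "\<not> 2 * len z \<le> len y" using sc_no_double by (auto simp: sc_def)
      with nd l show False by simp
    qed
    moreover from this have "z \<noteq> x" using assms by auto
    ultimately show ?thesis using that z l m by blast
  qed (use assms in \<open>auto simp: sc_def\<close>)
qed

lemma sc_unique_child:
  assumes "y \<in> V" "sc y x" "sc y x'"
  shows "x = x'"
proof -
  from assms(1,2) obtain z where "y = Cat x z \<or> y = Cat z x" "\<not> sc y z" by (rule sc_Cat)
  with assms(3) show ?thesis by (auto simp: sc_def split: if_splits)
qed

text \<open>Occurrences of \<open>x\<close> below \<open>y\<close> and below its parent on the path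
  are disjoint. This is what lets the climbing costs telescope: a node reached by a light edge has
  at least as many entries as the source has occurrences.\<close>

lemma entry_light:
  assumes "y \<in> V" "0 < mult y x" "\<not> sc y x"
  shows "occ y r \<le> entry x"
proof -
  have "(\<Sum>y'\<in>insert y {y\<in>V. sc y x}. occ y' r) \<le> occ x r"
    using assms by (intro parents_occ) (auto simp: sc_def)
  with assms(3) show ?thesis by (simp add: entry_def)
qed

lemma entry_sc:
  assumes "y \<in> V" "sc y x"
  shows "entry x + occ y r \<le> occ x r"
proof -
  have "occ y r \<le> (\<Sum>y\<in>{y\<in>V. sc y x}. occ y r)"
    using assms by (intro member_le_sum) auto
  moreover have "(\<Sum>y\<in>{y\<in>V. sc y x}. occ y r) \<le> occ x r"
    by (intro parents_occ) (auto simp: sc_def)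
  ultimately show ?thesis by (simp add: entry_def)
qed

lemma entry_le: "entry x \<le> occ x r"
  by (simp add: entry_def)

lemma entry_root: "entry r = 1"
proof -
  have "{y\<in>V. sc y r} = {}"
    using size_subs size_mult by (auto simp: sc_def dest!: size_subs size_mult)
  then show ?thesis by (simp only: entry_def) (simp add: occ_self)
qed

lemma level_sc: "sc y x \<Longrightarrow> level x = level y"
  by (simp add: sc_def level_def)

lemma level_light:
  assumes "y \<in> V" "0 < mult y x" "\<not> sc y x"
  shows "level x < level y"
proof -
  have x: "x \<in> V" using assms child_V by blast
  have "lglen x \<le> lglen y" "lgocc y \<le> lgocc x"
    using child_len child_occ assms by (auto intro!: floor_log_le_iff)
  moreover have "lglen x \<noteq> lglen y \<or> lgocc y \<noteq> lgocc x" using assms by (auto simp: sc_def)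
  ultimately show ?thesis using lgocc_le[OF x] unfolding level_def by linarith
qed

section \<open>The paths formed by the edges \<open>sc\<close>\<close>

definition nxt :: "'a expr \<Rightarrow> 'a expr option" where
  "nxt y = (if \<exists>x. sc y x then Some (SOME x. sc y x) else None)"

lemma nxt_sc: "nxt y = Some x \<Longrightarrow> sc y x"
  unfolding nxt_def by (auto split: if_splits intro: someI)

lemma nxt_None: "nxt y = None \<longleftrightarrow> (\<forall>x. \<not> sc y x)"
  by (auto simp: nxt_def)

lemma nxt_V: "nxt y = Some x \<Longrightarrow> y \<in> V \<Longrightarrow> x \<in> V"
  using nxt_sc child_V by (auto simp: sc_def)

lemma sc_nxt: "y \<in> V \<Longrightarrow> sc y x \<Longrightarrow> nxt y = Some x"
  using sc_unique_child nxt_sc nxt_None by (metis option.exhaust)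

function path :: "'a expr \<Rightarrow> 'a expr list" where
  "path y = y # (case nxt y of None \<Rightarrow> [] | Some x \<Rightarrow> path x)"
  by auto
termination
  by (relation "measure size") (auto dest!: nxt_sc simp: sc_def intro: size_mult)

declare path.simps [simp del]

lemma path_None: "nxt y = None \<Longrightarrow> path y = [y]"
  by (simp add: path.simps)

lemma path_Some: "nxt y = Some x \<Longrightarrow> path y = y # path x"
  by (subst path.simps) simp

lemma path_ne [simp]: "path y \<noteq> []"
  by (subst path.simps) simp

lemma path_self [simp]: "y \<in> set (path y)"
  by (subst path.simps) simp

lemma path_induct [case_names last step]:
  assumes "\<And>y. nxt y = None \<Longrightarrow> P y" "\<And>y x. nxt y = Some x \<Longrightarrow> P x \<Longrightarrow> P y"
  shows "P y"
  by (induction y rule: path.induct) (metis assms option.exhaust)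

lemma path_props:
  "x \<in> set (path y) \<Longrightarrow> (y \<in> V \<longrightarrow> x \<in> V) \<and> size x \<le> size y \<and> lglen x = lglen y \<and> lgocc x = lgocc y \<and>
    level x = level y"
proof (induction y rule: path_induct)
  case (last y)
  then show ?case by (simp add: path_None)
next
  case (step y z)
  have "sc y z" using step nxt_sc by blast
  moreover have "y \<in> V \<Longrightarrow> z \<in> V" using nxt_V step by blast
  ultimately show ?case using step size_mult[of y z] level_sc[of y z]
    by (auto simp: path_Some sc_def)
qed

lemma path_distinct: "distinct (path y)"
proof (induction y rule: path_induct)
  case (step y z)
  then have "size z < size y" using nxt_sc size_mult by (auto simp: sc_def)
  with step path_props[of y z] show ?case by (auto simp: path_Some)
qed (simp add: path_None)

lemma last_path: "nxt (last (path y)) = None"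
  by (induction y rule: path_induct) (auto simp: path_None path_Some)

lemma path_closed: "x \<in> set (path y) \<Longrightarrow> nxt x = Some z \<Longrightarrow> z \<in> set (path y)"
  by (induction y rule: path_induct) (auto simp: path_None path_Some)

lemma path_pred: "x \<in> set (path y) \<Longrightarrow> x \<noteq> y \<Longrightarrow> \<exists>z\<in>set (path y). nxt z = Some x"
  by (induction y rule: path_induct) (auto simp: path_None path_Some)

lemma nxt_butlast: "x \<in> set (butlast (path y)) \<Longrightarrow> nxt x \<noteq> None"
  by (induction y rule: path_induct) (auto simp: path_None path_Some)

text \<open>Matches the suffixes treated by \<open>wraps\<close> with the paths that start at inner
  nodes.\<close>

lemma suffix_path: "x \<in> set (butlast (path y)) \<Longrightarrow> suffix_from x (butlast (path y)) = butlast (path x)"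
proof (induction y rule: path_induct)
  case (step y z)
  then show ?case by (cases "x = y") (auto simp: path_Some)
qed (simp add: path_None)

section \<open>Children hanging off a path, and the rebalancing of one path\<close>

definition off :: "'a expr \<Rightarrow> 'a expr" where
  "off y = (case y of Cat a b \<Rightarrow> if nxt y = Some a then b else a | _ \<Rightarrow> y)"

text \<open>The side on which the path continues is padded with \<open>Emp\<close>, so that every
  path node offers an expression on both sides; \<open>norm_expr\<close> removes the
  padding.\<close>

definition off_l :: "('a expr \<Rightarrow> 'a expr) \<Rightarrow> 'a expr \<Rightarrow> 'a expr" where
  "off_l B y = (case y of Cat a b \<Rightarrow> if nxt y = Some a then Emp else B a | _ \<Rightarrow> Emp)"

definition off_r :: "('a expr \<Rightarrow> 'a expr) \<Rightarrow> 'a expr \<Rightarrow> 'a expr" where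
  "off_r B y = (case y of Cat a b \<Rightarrow> if nxt y = Some a then B b else Emp | _ \<Rightarrow> Emp)"

lemma off_props:
  assumes "y \<in> V" "nxt y = Some x"
  shows "0 < mult y (off y)" "\<not> sc y (off y)" "len y = len x + len (off y)"
    "y = Cat x (off y) \<and> off_l B y = Emp \<and> off_r B y = B (off y) \<or>
     y = Cat (off y) x \<and> off_l B y = B (off y) \<and> off_r B y = Emp"
proof -
  from assms have "sc y x" using nxt_sc by blast
  with assms(1) obtain z where "y = Cat x z \<or> y = Cat z x" "z \<noteq> x" "0 < mult y z" "\<not> sc y z"
    "len y = len x + len z"
    by (rule sc_Cat)
  note z = this
  have "0 < mult y (off y) \<and> \<not> sc y (off y) \<and> len y = len x + len (off y) \<and>
      (y = Cat x (off y) \<and> off_l B y = Emp \<and> off_r B y = B (off y) \<or>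
       y = Cat (off y) x \<and> off_l B y = B (off y) \<and> off_r B y = Emp)"
    using z(1)
  proof
    assume y: "y = Cat x z"
    then have "nxt (Cat x z) = Some x" using assms by simp
    with y have "off y = z" "off_l B y = Emp" "off_r B y = B z"
      by (simp_all add: off_def off_l_def off_r_def)
    with z y show ?thesis by simp
  next
    assume y: "y = Cat z x"
    then have "nxt (Cat z x) = Some x" using assms by simp
    with y z(2) have "off y = z" "off_l B y = B z" "off_r B y = Emp"
      by (simp_all add: off_def off_l_def off_r_def)
    with z y show ?thesis by simp
  qed
  then show "0 < mult y (off y)" "\<not> sc y (off y)" "len y = len x + len (off y)"
    "y = Cat x (off y) \<and> off_l B y = Emp \<and> off_r B y = B (off y) \<or>
     y = Cat (off y) x \<and> off_l B y = B (off y) \<and> off_r B y = Emp"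
    by blast+
qed

lemma path_yield:
  assumes "y \<in> V" "\<And>x. x \<in> V \<Longrightarrow> level x < level y \<Longrightarrow> yield (B x) = yield x"
  shows "yield y = cat_l (off_l B) (butlast (path y)) @ yield (last (path y)) @ cat_r (off_r B) (butlast (path y))"
  using assms
proof (induction y rule: path_induct)
  case (last y)
  then show ?case by (simp add: path_None)
next
  case (step y x)
  note o = off_props[OF step.prems(1) step.hyps(1)]
  have x: "x \<in> V" "level x = level y" using nxt_V nxt_sc level_sc step by blast+
  have "off y \<in> V" "level (off y) < level y" using child_V level_light step.prems(1) o by blast+
  then have "yield (B (off y)) = yield (off y)" using step.prems by blast
  with o(4)[of B] have "yield y = yield (off_l B y) @ yield x @ yield (off_r B y)"
    by (metis append_Nil append_Nil2 yield.simps(1,3))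
  moreover have "yield x = cat_l (off_l B) (butlast (path x)) @ yield (last (path x)) @ cat_r (off_r B) (butlast (path x))"
    using step x by simp
  ultimately show ?case by (simp add: path_Some[OF step.hyps(1)])
qed

lemma path_len_sum:
  "y \<in> V \<Longrightarrow> (\<Sum>x\<leftarrow>butlast (path y). len (off x)) + len (last (path y)) = len y"
proof (induction y rule: path_induct)
  case (step y x)
  then have "len y = len x + len (off y)" "x \<in> V" using off_props(3) nxt_V by blast+
  then show ?case using step.IH by (simp add: path_Some[OF step.hyps(1)])
qed (simp add: path_None)

text \<open>Telescoping of \<open>entry_sc\<close>. Together with \<open>entry_le\<close> it bounds
  all entries of a path by the occurrences of its last node.\<close>

lemma path_entry_sum:
  "y \<in> V \<Longrightarrow> (\<Sum>x\<leftarrow>path y. entry x) + occ y r \<le> entry y + occ (last (path y)) r"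
proof (induction y rule: path_induct)
  case (step y x)
  then have "entry x + occ y r \<le> occ x r" "x \<in> V" using nxt_sc nxt_V entry_sc by blast+
  then show ?case using step.IH by (simp add: path_Some[OF step.hyps(1)])
qed (simp add: path_None)

lemma last_path_eq: "x \<in> set (path y) \<Longrightarrow> last (path x) = last (path y)"
  by (induction y rule: path_induct) (auto simp: path_None path_Some)

text \<open>In the height bound, the first term pays for climbing to the place where a path is left, the
  second for descending to it, and the last for the constant overhead of every path.\<close>

definition balanced :: "('a expr \<Rightarrow> 'a expr) \<Rightarrow> 'a expr \<Rightarrow> bool" where
  "balanced B x \<longleftrightarrow> yield (B x) = yield x \<and> (0 < entry x \<longrightarrow>
     height (B x) \<le> 3 * (lglen r - floor_log (entry x)) + 2 * lglen x + 10 * level x)"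

text \<open>By \<open>entry_light\<close> the climbing term of \<open>x\<close> is at most
  \<open>3 * (lglen r - lgocc y)\<close>, and the drop of the level by at least 1 leaves 10 to
  spare.\<close>

lemma balance_light:
  assumes B: "\<forall>x\<in>V. level x < level y \<longrightarrow> balanced B x"
    and y: "y \<in> V" and x: "0 < mult y x" "\<not> sc y x"
  shows "x \<in> V" "yield (B x) = yield x"
    "height (B x) + 10 \<le> 3 * (lglen r - lgocc y) + 2 * lglen x + 10 * level y"
proof -
  show xV: "x \<in> V" using y x child_V by blast
  have lv: "level x < level y" using level_light y x by blast
  with B xV have b: "balanced B x" by blast
  then show "yield (B x) = yield x" by (simp add: balanced_def)
  have "occ y r \<le> entry x" using entry_light y x by blast
  with V_occ[OF y] have "0 < entry x" "lgocc y \<le> floor_log (entry x)"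
    by (auto intro: floor_log_le_iff)
  with b lv show "height (B x) + 10 \<le> 3 * (lglen r - lgocc y) + 2 * lglen x + 10 * level y"
    by (auto simp: balanced_def)
qed

text \<open>No path edge leaves \<open>y\<close>, so all its children are balanced already and one
  node on top of them suffices. The 6 is kept back for the climb in
  \<open>balance_path\<close>.\<close>

lemma balance_last:
  assumes B: "\<forall>x\<in>V. level x < level y \<longrightarrow> balanced B x"
    and y: "y \<in> V" "nxt y = None"
    and Q: "\<forall>x\<in>V. level x < level y \<longrightarrow> subs (B x) \<subseteq> Q"
  obtains e where "yield e = yield y" "subs e \<subseteq> insert e Q"
    "height e \<le> 3 * (lglen r - lgocc y) + 2 * lglen y + 10 * level y - 6"
proof -
  define e where "e = (case y of Cat a b \<Rightarrow> Cat (B a) (B b) | Rep a t \<Rightarrow> Rep (B a) t | _ \<Rightarrow> y)"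
  have light: "\<not> sc y x" for x using y(2) nxt_None by blast
  note bl = balance_light[OF B y(1) _ light]
  have subs: "subs (B x) \<subseteq> Q" if "0 < mult y x" for x
    using Q level_light[OF y(1) that light] bl(1)[OF that] by blast
  have ht: "height (B x) + 10 \<le> 3 * (lglen r - lgocc y) + 2 * lglen y + 10 * level y"
    if "0 < mult y x" for x
    using bl(3)[OF that] floor_log_le_iff[OF child_len[OF y(1) that]] by linarith
  have "yield e = yield y \<and> subs e \<subseteq> insert e Q \<and>
    height e \<le> 3 * (lglen r - lgocc y) + 2 * lglen y + 10 * level y - 6"
  proof (cases y)
    case (Cat a b)
    then have "0 < mult y a" "0 < mult y b" by auto
    with bl(2)[of a] bl(2)[of b] subs[of a] subs[of b] ht[of a] ht[of b] Cat show ?thesis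
      by (auto simp: e_def)
  next
    case (Rep a t)
    then have "0 < mult y a" using V_ok[OF y(1)] by auto
    with bl(2)[of a] subs[of a] ht[of a] Rep show ?thesis
      by (auto simp: e_def)
  qed (use V_ok[OF y(1)] in \<open>auto simp: e_def\<close>)
  then show ?thesis using that by blast
qed

text \<open>All nodes of a path have the same level, so only children off the path must have been
  balanced before; \<open>Q\<close> collects their subexpressions, and all else is charged to path
  nodes.\<close>

lemma balance_path:
  assumes B: "\<forall>x\<in>V. level x < level t \<longrightarrow> balanced B x"
    and t: "t \<in> V"
    and Q: "\<forall>x\<in>V. level x < level t \<longrightarrow> subs (B x) \<subseteq> Q"
  shows "\<exists>S N. (\<forall>v. finite (N v) \<and> card (N v) \<le> 8) \<and> (\<forall>v\<in>set (path t). balanced S v \<and>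
    subs (S v) \<subseteq> insert Emp (\<Union>w\<in>set (path t). N w) \<union> Q)"
proof -
  define y where "y = last (path t)"
  define vs where "vs = butlast (path t)"
  define k where "k = lglen t"
  define c where "c = lgocc t"
  have path: "path t = vs @ [y]" by (simp add: vs_def y_def)
  have pr: "v \<in> V" "lglen v = k" "lgocc v = c" "level v = level t" if "v \<in> set (path t)" for v
    using path_props[OF that] t by (auto simp: k_def c_def)
  have yp: "y \<in> set (path t)" by (simp add: path)
  \<comment> \<open>The total weight stays below \<open>2 ^ (k + c + 2)\<close>, two levels above
    \<open>k + c\<close>. Of the 10 units gained at a light edge, the descent spends
    \<open>2 * 2\<close> on these levels; the other 6 are the \<open>3 * 2\<close> of the
    climb.\<close>
  define H where "H = 3 * (lglen r - c) + 2 * k + 10 * level t - 6"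
  obtain e where e: "yield e = yield y" "subs e \<subseteq> insert e Q" "height e \<le> H"
    by (rule balance_last[of y B Q]) (use B Q pr[OF yp] last_path in \<open>auto simp: H_def y_def\<close>)
  \<comment> \<open>The factors put both kinds of weight on the common scale
    \<open>2 ^ (k + c)\<close>, so each element is at least as shallow as either kind alone
    demands.\<close>
  define p where "p = (\<lambda>v. 2 ^ c * len (off v) + 2 ^ k * entry v)"
  have items: "\<exists>x. nxt v = Some x" if "v \<in> set vs" for v
    using nxt_butlast that unfolding vs_def by blast
  have "distinct vs" using path_distinct[of t] by (simp add: path)
  have offV: "off v \<in> V" "0 < len (off v)" if v: "v \<in> set vs" for v
  proof -
    obtain x where "nxt v = Some x" using items v by blast
    moreover have "v \<in> V" using pr(1) v by (simp add: path)
    ultimately show "off v \<in> V" using off_props(1) child_V by blast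
    then show "0 < len (off v)" by (rule V_len)
  qed
  then have p0: "\<forall>v\<in>set vs. 0 < p v" by (simp add: p_def)
  have "sum_list (map p vs) = 2 ^ c * (\<Sum>v\<leftarrow>vs. len (off v)) + 2 ^ k * (\<Sum>v\<leftarrow>vs. entry v)"
    by (simp add: p_def sum_list_addf sum_list_const_mult)
  \<comment> \<open>From \<open>len t < 2 * 2 ^ k\<close> and \<open>len y \<ge> 2 ^ k\<close>, less
    than \<open>2 ^ k\<close> remains for the children off the path; the entries total at most
    \<open>occ y r\<close>.\<close>
  also have "\<dots> < 2 ^ c * 2 ^ k + 2 ^ k * (2 * 2 ^ c)"
  proof (intro add_less_le_mono mult_strict_left_mono mult_left_mono)
    have "(\<Sum>v\<leftarrow>vs. len (off v)) + len y = len t"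
      using path_len_sum[OF t] by (simp add: vs_def y_def)
    moreover have "2 ^ k \<le> len y"
      using floor_log_exp2_le[OF V_len[OF pr(1)[OF yp]]] pr(2)[OF yp] by simp
    moreover have "len t < 2 * 2 ^ k" using floor_log_exp2_gt by (simp add: k_def)
    ultimately show "(\<Sum>v\<leftarrow>vs. len (off v)) < 2 ^ k" by linarith
    have "(\<Sum>x\<leftarrow>path t. entry x) + occ t r \<le> entry t + occ y r"
      using path_entry_sum[OF t] by (simp add: y_def)
    with entry_le[of t] have "(\<Sum>v\<leftarrow>vs. entry v) \<le> occ y r" by (simp add: path)
    moreover have "occ y r \<le> 2 * 2 ^ c" using floor_log_exp2_ge[of "occ y r"] pr(3)[OF yp] by simp
    ultimately show "(\<Sum>v\<leftarrow>vs. entry v) \<le> 2 * 2 ^ c" by linarith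
  qed auto
  also have "\<dots> \<le> 2 ^ (k + c + 2)" by (simp add: power_add)
  finally have psum: "sum_list (map p vs) < 2 ^ (k + c + 2)" .
  interpret bc: biased_contexts p "off_l B" "off_r B" .
  obtain S N where N: "bc.small 8 N" and S: "bc.wraps (k + c + 2) vs e S N"
    using bc.biased_wrap[OF \<open>distinct vs\<close> p0 psum] by blast
  have fits: "bc.fits (k + c + 2) vs H" unfolding bc.fits_def
  proof
    fix v assume v: "v \<in> set vs"
    then have vp: "v \<in> set (path t)" by (simp add: path)
    note pv = pr[OF vp]
    obtain x where x: "nxt v = Some x" using items v by blast
    note o = off_props[OF pv(1) x]
    have "\<forall>x\<in>V. level x < level v \<longrightarrow> balanced B x" using B pv(4) by simp
    note l = balance_light[OF this pv(1) o(1,2)]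
    have "lglen (off v) \<le> k" using child_len[OF pv(1) o(1)] floor_log_le_iff pv(2) by metis
    moreover have "c + lglen (off v) \<le> floor_log (p v)"
    proof -
      have "2 ^ c * 2 ^ lglen (off v) \<le> 2 ^ c * len (off v)"
        using floor_log_exp2_le[OF offV(2)[OF v]] by simp
      also have "\<dots> \<le> p v" by (simp add: p_def)
      finally have "2 ^ (c + lglen (off v)) \<le> p v" by (simp add: power_add)
      from floor_log_le_iff[OF this] show ?thesis by (simp only: floor_log_power)
    qed
    ultimately have "height (B (off v)) + 2 * (k + c + 2 - floor_log (p v)) \<le> H"
      using l(3) pv unfolding H_def by linarith
    with o(4)[of B] show "height (off_l B v) + 2 * (k + c + 2 - floor_log (p v)) \<le> H \<and>
        height (off_r B v) + 2 * (k + c + 2 - floor_log (p v)) \<le> H"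
      by auto
  qed
  have charged: "bc.charged N vs \<subseteq> insert Emp (\<Union>w\<in>set vs. N w) \<union> Q"
  proof -
    have "subs (off_l B v) \<union> subs (off_r B v) \<subseteq> insert Emp Q" if v: "v \<in> set vs" for v
    proof -
      have vp: "v \<in> set (path t)" using v by (simp add: path)
      obtain x where x: "nxt v = Some x" using items v by blast
      note o = off_props[OF pr(1)[OF vp] x]
      have "level (off v) < level t" using level_light[OF pr(1)[OF vp] o(1,2)] pr(4)[OF vp] by simp
      with Q offV(1)[OF v] have "subs (B (off v)) \<subseteq> Q" by blast
      with o(4)[of B] show ?thesis by auto
    qed
    then show ?thesis unfolding bc.charged_def by blast
  qed
  define S' where "S' = S(y := e)"
  define N' where "N' = N(y := {e})"
  have ynot: "y \<notin> set vs" using path_distinct[of t] by (simp add: path)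
  have Neq: "(\<Union>w\<in>set (path t). N' w) = insert e (\<Union>w\<in>set vs. N w)"
    using ynot by (auto simp: path N'_def)
  have "balanced S' v \<and> subs (S' v) \<subseteq> insert Emp (\<Union>w\<in>set (path t). N' w) \<union> Q"
    if v: "v \<in> set (path t)" for v
  proof (cases "v = y")
    case True
    have "floor_log (entry y) \<le> c" using floor_log_le_iff[OF entry_le[of y]] pr(3)[OF yp] by simp
    with True e pr[OF yp] show ?thesis
      unfolding Neq by (auto simp: S'_def balanced_def H_def)
  next
    case False
    with v have vv: "v \<in> set vs" by (simp add: path)
    note w = S[unfolded bc.wraps_def, rule_format, OF vv]
    have "balanced S v" unfolding balanced_def
    proof
      have "yield x = yield (B x)" if "x \<in> V" "level x < level v" for x
        using B that pr(4)[OF v] by (simp add: balanced_def)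
      then have "yield v = cat_l (off_l B) (butlast (path v)) @ yield (last (path v)) @
          cat_r (off_r B) (butlast (path v))"
        using path_yield[OF pr(1)[OF v], of B] by simp
      moreover have "last (path v) = y"
        using last_path_eq[OF v] by (simp add: y_def)
      ultimately show "yield (S v) = yield v"
        using w suffix_path[of v t] vv e(1) by (simp add: vs_def)
      show "0 < entry v \<longrightarrow>
        height (S v) \<le> 3 * (lglen r - floor_log (entry v)) + 2 * lglen v + 10 * level v"
      proof
        assume en: "0 < entry v"
        have "height (S v) \<le> 3 * (k + c + 2 - floor_log (p v)) + H"
          using w fits e(3) by (metis max.absorb1)
        moreover have "k + floor_log (entry v) \<le> floor_log (p v)"
        proof -
          have "2 ^ k * 2 ^ floor_log (entry v) \<le> 2 ^ k * entry v"
            using floor_log_exp2_le[OF en] by simp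
          also have "\<dots> \<le> p v" by (simp add: p_def)
          finally have "2 ^ (k + floor_log (entry v)) \<le> p v" by (simp add: power_add)
          from floor_log_le_iff[OF this] show ?thesis by (simp only: floor_log_power)
        qed
        moreover have "floor_log (entry v) \<le> c"
          using floor_log_le_iff[OF entry_le[of v]] pr(3)[OF v] by simp
        moreover have "c \<le> lglen r" using lgocc_le[OF t] by (simp add: c_def)
        \<comment> \<open>Ensures that the subtraction of 6 in \<open>H\<close> is not
          truncated.\<close>
        moreover have "1 \<le> level t"
        proof -
          obtain x where x: "nxt v = Some x" using items vv by blast
          note o = off_props[OF pr(1)[OF v] x]
          show ?thesis using level_light[OF pr(1)[OF v] o(1,2)] pr(4)[OF v] by simp
        qed
        ultimately show "height (S v) \<le> 3 * (lglen r - floor_log (entry v)) + 2 * lglen v + 10 * level v"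
          using pr[OF v] unfolding H_def by linarith
      qed
    qed
    moreover have "subs (S v) \<subseteq> insert Emp (\<Union>w\<in>set (path t). N' w) \<union> Q"
      using w charged e(2) unfolding Neq by blast
    ultimately show ?thesis using False by (simp add: S'_def balanced_def)
  qed
  moreover have "\<forall>v. finite (N' v) \<and> card (N' v) \<le> 8"
    using N by (auto simp: N'_def bc.small_def)
  ultimately show ?thesis by blast
qed

section \<open>Partition into maximal paths and assembly by levels\<close>

definition top :: "'a expr \<Rightarrow> bool" where
  "top t \<longleftrightarrow> t \<in> V \<and> (\<forall>y\<in>V. \<not> sc y t)"

lemma top_exists: "x \<in> V \<Longrightarrow> \<exists>t. top t \<and> x \<in> set (path t)"
proof (induction "size r - size x" arbitrary: x rule: less_induct)
  case less
  show ?case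
  proof (cases "top x")
    case False
    then obtain y where y: "y \<in> V" "sc y x" using less.prems by (auto simp: top_def)
    then have "size x < size y" "size y \<le> size r"
      using size_mult size_subs by (auto simp: sc_def)
    then have "size r - size y < size r - size x" by linarith
    then obtain t where "top t" "y \<in> set (path t)"
      using less.hyps y(1) by blast
    with y sc_nxt path_closed show ?thesis by blast
  qed auto
qed

lemma top_pred: "x \<in> set (path t) \<Longrightarrow> y \<in> V \<Longrightarrow> sc y x \<Longrightarrow> top t \<Longrightarrow> y \<in> set (path t)"
proof -
  assume a: "x \<in> set (path t)" "y \<in> V" "sc y x" "top t"
  then have "x \<noteq> t" by (auto simp: top_def)
  then obtain z where "z \<in> set (path t)" "nxt z = Some x" using path_pred a by blast
  moreover from this a have "z \<in> V" "sc z x" using path_props nxt_sc by (auto simp: top_def)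
  ultimately show ?thesis using sc_unique_parent a by blast
qed

lemma top_unique:
  "x \<in> V \<Longrightarrow> x \<in> set (path t) \<Longrightarrow> x \<in> set (path t') \<Longrightarrow> top t \<Longrightarrow> top t' \<Longrightarrow> t = t'"
proof (induction "size r - size x" arbitrary: x rule: less_induct)
  case less
  show ?case
  proof (cases "top x")
    case False
    then obtain y where y: "y \<in> V" "sc y x" using less.prems by (auto simp: top_def)
    then have "size x < size y" "size y \<le> size r"
      using size_mult size_subs by (auto simp: sc_def)
    then have "size r - size y < size r - size x" by linarith
    then show ?thesis using less.hyps y less.prems top_pred by blast
  next
    case True
    have "x = s" if s: "x \<in> set (path s)" "top s" for s
    proof (rule ccontr)
      assume "x \<noteq> s"
      then obtain z where "z \<in> set (path s)" "nxt z = Some x" using path_pred s by blast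
      moreover from this have "z \<in> V" using path_props s(2) by (auto simp: top_def)
      ultimately show False using nxt_sc True by (auto simp: top_def)
    qed
    with less.prems show ?thesis by metis
  qed
qed

definition top_of :: "'a expr \<Rightarrow> 'a expr" where
  "top_of x = (SOME t. top t \<and> x \<in> set (path t))"

lemma top_of: "x \<in> V \<Longrightarrow> top (top_of x)" "x \<in> V \<Longrightarrow> x \<in> set (path (top_of x))"
  using someI_ex[OF top_exists] by (auto simp: top_of_def)

lemma top_of_eq: "top t \<Longrightarrow> x \<in> set (path t) \<Longrightarrow> top_of x = t"
  using top_unique top_of path_props unfolding top_def by blast

definition balanced_below :: "nat \<Rightarrow> ('a expr \<Rightarrow> 'a expr) \<Rightarrow> ('a expr \<Rightarrow> 'a expr set) \<Rightarrow> bool" where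
  "balanced_below m B N \<longleftrightarrow> (\<forall>v. finite (N v) \<and> card (N v) \<le> 8) \<and> (\<forall>v\<in>V. level v < m \<longrightarrow>
    balanced B v \<and> subs (B v) \<subseteq> insert Emp (\<Union>w\<in>{w\<in>V. level w < m}. N w))"

text \<open>The induction is on levels because the expressions of one path share nodes and must be
  chosen together. Distinct paths of a level are independent, so each node takes the choice made for
  the top of its path.\<close>

lemma balance_levels: "\<exists>B N. balanced_below m B N"
proof (induction m)
  case 0
  show ?case by (intro exI[of _ "\<lambda>x. x"] exI[of _ "\<lambda>_. {}"]) (simp add: balanced_below_def)
next
  case (Suc m)
  then obtain B N where BN: "balanced_below m B N" by blast
  have N: "finite (N v)" "card (N v) \<le> 8" for v
    using BN unfolding balanced_below_def by auto
  have B: "balanced B v" "subs (B v) \<subseteq> insert Emp (\<Union>w\<in>{w\<in>V. level w < m}. N w)"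
    if "v \<in> V" "level v < m" for v
    using BN that unfolding balanced_below_def by auto
  let ?Q = "insert Emp (\<Union>w\<in>{w\<in>V. level w < m}. N w)"
  define good where "good = (\<lambda>t S N. (\<forall>v::'a expr. finite (N v :: 'a expr set) \<and> card (N v) \<le> 8) \<and>
    (\<forall>v\<in>set (path t). balanced S v \<and> subs (S v) \<subseteq> insert Emp (\<Union>w\<in>set (path t). N w) \<union> ?Q))"
  have "\<exists>S N. good t S N" if t: "t \<in> V" "level t = m" for t
    unfolding good_def by (rule balance_path[where B = B]) (use B t in simp_all)
  then obtain S M where SM: "\<And>t. t \<in> V \<Longrightarrow> level t = m \<Longrightarrow> good t (S t) (M t)"
    by metis
  define B' where "B' = (\<lambda>v. if level v < m then B v else S (top_of v) v)"
  define N' where "N' = (\<lambda>v. if level v < m then N v else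
    if v \<in> V \<and> level v = m then M (top_of v) v else {})"
  have top: "top_of v \<in> V" "level (top_of v) = level v" if "v \<in> V" for v
    using top_of[OF that] path_props[OF top_of(2)[OF that]] by (auto simp: top_def)
  have "finite (N' v) \<and> card (N' v) \<le> 8" for v
    using N SM[of "top_of v"] top[of v] by (auto simp: N'_def good_def)
  moreover have "balanced B' v \<and> subs (B' v) \<subseteq> insert Emp (\<Union>w\<in>{w\<in>V. level w < Suc m}. N' w)"
    if v: "v \<in> V" "level v < Suc m" for v
  proof -
    have Q: "?Q \<subseteq> insert Emp (\<Union>w\<in>{w\<in>V. level w < Suc m}. N' w)"
      by (auto simp: N'_def)
    show ?thesis
    proof (cases "level v < m")
      case True
      then have "B' v = B v" by (simp add: B'_def)
      moreover have "subs (B v) \<subseteq> insert Emp (\<Union>w\<in>{w\<in>V. level w < Suc m}. N' w)"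
        using B(2)[OF v(1) True] Q by (rule subset_trans)
      ultimately show ?thesis using B(1)[OF v(1) True] by (simp add: balanced_def)
    next
      case False
      with v have lv: "level v = m" by simp
      let ?t = "top_of v"
      have eq: "B' v = S ?t v" using False by (simp add: B'_def)
      have t: "?t \<in> V" "level ?t = m" using top v lv by auto
      have "M ?t w \<subseteq> N' w \<and> w \<in> V \<and> level w < Suc m" if "w \<in> set (path ?t)" for w
      proof -
        have "w \<in> V" "level w = m" using path_props[OF that] t by auto
        moreover have "top_of w = ?t" using top_of_eq that top_of v by blast
        ultimately show ?thesis by (auto simp: N'_def)
      qed
      then have "(\<Union>w\<in>set (path ?t). M ?t w) \<subseteq> (\<Union>w\<in>{w\<in>V. level w < Suc m}. N' w)"
        by blast
      note U = Un_least[OF insert_mono[OF this] Q]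
      have b: "balanced (S ?t) v" "subs (S ?t v) \<subseteq> insert Emp (\<Union>w\<in>set (path ?t). M ?t w) \<union> ?Q"
        using SM[OF t] top_of(2)[OF v(1)] unfolding good_def by blast+
      show ?thesis using b(1) subset_trans[OF b(2) U] by (simp add: eq balanced_def)
    qed
  qed
  ultimately have "balanced_below (Suc m) B' N'"
    unfolding balanced_below_def by simp
  then show ?case by blast
qed

text \<open>The root has one entry and level \<open>2 * lglen r\<close>, so the three terms of the
  height add up to 3 + 2 + 20 times \<open>lglen r\<close>. The extra subexpression is the common
  \<open>Emp\<close>.\<close>

lemma balance:
  "\<exists>e. yield e = yield r \<and> card (subs e) \<le> 8 * card V + 1 \<and> height e \<le> 25 * lglen r"
proof -
  obtain B N where BN: "balanced_below (Suc (level r)) B N" using balance_levels by blast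
  have N: "finite (N v)" "card (N v) \<le> 8" for v
    using BN unfolding balanced_below_def by auto
  have B: "balanced B r" "subs (B r) \<subseteq> insert Emp (\<Union>w\<in>{w\<in>V. level w < Suc (level r)}. N w)"
    using BN unfolding balanced_below_def by auto
  have "card (\<Union>w\<in>V. N w) \<le> (\<Sum>w\<in>V. card (N w))" by (rule card_UN_le) simp
  also have "\<dots> \<le> 8 * card V" using sum_bounded_above[of V "\<lambda>w. card (N w)" 8] N(2) by simp
  finally have "card (\<Union>w\<in>V. N w) \<le> 8 * card V" .
  moreover have "card (insert Emp (\<Union>w\<in>V. N w)) \<le> Suc (card (\<Union>w\<in>V. N w))"
    using N by (simp add: card_insert_if)
  moreover have "card (subs (B r)) \<le> card (insert Emp (\<Union>w\<in>V. N w))"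
    using B(2) N by (intro card_mono) auto
  ultimately have "card (subs (B r)) \<le> 8 * card V + 1" by linarith
  moreover have "height (B r) \<le> 25 * lglen r"
    using B(1) by (simp add: balanced_def entry_root level_def occ_self)
  ultimately show ?thesis using B(1) by (auto simp: balanced_def)
qed

end

subsection \<open>Expressions from run-length straight-line programs\<close>

fun cats :: "'a expr list \<Rightarrow> 'a expr" where
  "cats [] = Emp"
| "cats [x] = x"
| "cats (x # y # xs) = Cat x (cats (y # xs))"

lemma yield_cats [simp]: "yield (cats xs) = concat (map yield xs)"
  by (induction xs rule: cats.induct) auto

lemma ok_cats: "xs \<noteq> [] \<Longrightarrow> \<forall>x\<in>set xs. ok x \<Longrightarrow> ok (cats xs)"
  by (induction xs rule: cats.induct) auto

lemma subs_cats:
  "xs \<noteq> [] \<Longrightarrow> subs (cats xs) \<subseteq> (\<lambda>i. cats (drop i xs)) ` {..<length xs - 1} \<union> \<Union> (subs ` set xs)"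
proof (induction xs rule: cats.induct)
  case (3 x y xs)
  let ?f = "\<lambda>i. cats (drop i (x # y # xs))"
  have "(\<lambda>i. cats (drop i (y # xs))) ` {..<length xs} \<subseteq> ?f ` {..<Suc (length xs)}"
  proof
    fix z assume "z \<in> (\<lambda>i. cats (drop i (y # xs))) ` {..<length xs}"
    then obtain i where "i < length xs" "z = ?f (Suc i)" by auto
    then show "z \<in> ?f ` {..<Suc (length xs)}" by blast
  qed
  note b = this
  have a: "subs (cats (y # xs)) \<subseteq> (\<lambda>i. cats (drop i (y # xs))) ` {..<length xs} \<union> \<Union> (subs ` set (y # xs))"
    using "3.IH" by simp
  have "subs (cats (y # xs)) \<subseteq> ?f ` {..<Suc (length xs)} \<union> \<Union> (subs ` set (x # y # xs))"
    by (rule subset_trans[OF a Un_mono[OF b]]) auto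
  moreover have "cats (x # y # xs) \<in> ?f ` {..<Suc (length xs)}"
    by (rule image_eqI[of _ _ 0]) auto
  moreover have "subs (cats (x # y # xs)) = insert (cats (x # y # xs)) (subs x \<union> subs (cats (y # xs)))"
    by simp
  moreover have "subs x \<subseteq> \<Union> (subs ` set (x # y # xs))" by auto
  ultimately have "subs (cats (x # y # xs)) \<subseteq> ?f ` {..<Suc (length xs)} \<union> \<Union> (subs ` set (x # y # xs))"
    by (simp only: insert_subset Un_subset_iff) (simp only: Un_iff le_supI2 simp_thms)
  then show ?case by (simp del: cats.simps)
qed auto

text \<open>A grammar is a bare rule map, so the recursion is bounded by fuel; any amount above the
  rank of the variable gives the same result.\<close>

primrec unfold_var :: "'a grammar \<Rightarrow> nat \<Rightarrow> nat \<Rightarrow> 'a expr" where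
  "unfold_var G 0 A = Emp"
| "unfold_var G (Suc k) A = (case rules G A of
      None \<Rightarrow> Emp
    | Some r \<Rightarrow> (case r of
        Terminal a \<Rightarrow> Chr a
      | Concat Bs \<Rightarrow> cats (map (unfold_var G k) Bs)
      | Power B t \<Rightarrow> Rep (unfold_var G k B) t))"

lemma rlslp_expr:
  assumes G: "rlslp G" and w: "generates G w"
  obtains e where "ok e" "yield e = w" "card (subs e) \<le> grammar_size G"
proof -
  from G obtain ord where ord: "\<And>A r B. rules G A = Some r \<Longrightarrow> B \<in> rhs_vars r \<Longrightarrow> ord B < (ord A :: nat)"
    unfolding rlslp_def by blast
  from G have fin: "finite (dom (rules G))" and st: "start G \<in> dom (rules G)"
    and wf: "\<And>A r. rules G A = Some r \<Longrightarrow> rhs_wf r"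
    and cl: "\<And>A r B. rules G A = Some r \<Longrightarrow> B \<in> rhs_vars r \<Longrightarrow> B \<in> dom (rules G)"
    unfolding rlslp_def by blast+
  define E where "E = (\<lambda>A. unfold_var G (Suc (ord A)) A)"
  have stable: "unfold_var G k A = unfold_var G k' A" if "ord A < k" "ord A < k'" for k k' A
    using that
  proof (induction "ord A" arbitrary: A k k' rule: less_induct)
    case less
    obtain j j' where k: "k = Suc j" "k' = Suc j'" using less.prems by (cases k; cases k') auto
    have "unfold_var G j B = unfold_var G j' B" if "rules G A = Some r" "B \<in> rhs_vars r" for r B
      using ord[OF that] less.prems by (intro less.hyps) (auto simp: k)
    then show ?case
      by (auto simp: k split: option.split rhs.split intro!: arg_cong[of _ _ cats])
  qed
  have E: "E A = (case r of Terminal a \<Rightarrow> Chr a | Concat Bs \<Rightarrow> cats (map E Bs) | Power B t \<Rightarrow> Rep (E B) t)"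
    if r: "rules G A = Some r" for A r
  proof -
    have "unfold_var G (ord A) B = E B" if "B \<in> rhs_vars r" for B
      using ord[OF r that] unfolding E_def by (intro stable) auto
    then show ?thesis using r
      by (auto simp: E_def split: rhs.split intro!: arg_cong[of _ _ cats])
  qed
  have yield: "yield (E A) = s" if "derives G A s" for A s
    using that
  proof induction
    case (concat A Bs ss)
    from concat.IH have "map (\<lambda>B. yield (E B)) Bs = ss"
      by (induction rule: list_all2_induct) auto
    then show ?case using E[OF concat.hyps(1)] by (simp add: comp_def)
  qed (simp_all add: E)
  \<comment> \<open>Each rule pays for what it adds. In a concatenation only suffixes of at least
    two variables are new, since the last variable is paid for by its own rule.\<close>
  define new where "new = (\<lambda>A. case the (rules G A) of Terminal a \<Rightarrow> {Chr a}
    | Concat Bs \<Rightarrow> (\<lambda>i. cats (drop i (map E Bs))) ` {..<length Bs - 1} | Power B t \<Rightarrow> {E A})"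
  have new: "finite (new A) \<and> card (new A) \<le> rhs_size (the (rules G A))" for A
  proof (cases "the (rules G A)")
    case (Concat Bs)
    then show ?thesis
      using card_image_le[of "{..<length Bs - 1}" "\<lambda>i. cats (drop i (map E Bs))"]
      by (auto simp: new_def)
  qed (auto simp: new_def)
  have "ok (E A) \<and> subs (E A) \<subseteq> (\<Union>A\<in>dom (rules G). new A)" if "A \<in> dom (rules G)" for A
    using that
  proof (induction "ord A" arbitrary: A rule: less_induct)
    case less
    then obtain r where r: "rules G A = Some r" by blast
    have IH: "ok (E B) \<and> subs (E B) \<subseteq> (\<Union>A\<in>dom (rules G). new A)" if "B \<in> rhs_vars r" for B
      by (rule less.hyps[OF ord[OF r that] cl[OF r that]])
    have nA: "new A \<subseteq> (\<Union>A\<in>dom (rules G). new A)" using less.prems by (rule UN_upper)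
    show ?case
    proof (cases r)
      case (Terminal a)
      then show ?thesis using E[OF r] nA r by (simp add: new_def)
    next
      case (Power B t)
      then show ?thesis using E[OF r] nA r IH[of B] wf[OF r] by (simp add: new_def)
    next
      case (Concat Bs)
      then have "Bs \<noteq> []" using wf[OF r] by auto
      then have "subs (cats (map E Bs)) \<subseteq> new A \<union> (\<Union>B\<in>set Bs. subs (E B))"
        using subs_cats[of "map E Bs"] r Concat by (simp add: new_def)
      moreover have "ok (cats (map E Bs))"
        using \<open>Bs \<noteq> []\<close> IH Concat by (intro ok_cats) auto
      moreover have "(\<Union>B\<in>set Bs. subs (E B)) \<subseteq> (\<Union>A\<in>dom (rules G). new A)"
        using IH Concat by (intro UN_least) auto
      ultimately show ?thesis using nA
        by (simp only: E[OF r] Concat rhs.case) (meson Un_least subset_trans)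
    qed
  qed
  with st have e: "ok (E (start G))" "subs (E (start G)) \<subseteq> (\<Union>A\<in>dom (rules G). new A)" by blast+
  have "card (subs (E (start G))) \<le> card (\<Union>A\<in>dom (rules G). new A)"
    using e(2) fin new by (intro card_mono) auto
  also have "\<dots> \<le> (\<Sum>A\<in>dom (rules G). card (new A))" using fin by (rule card_UN_le)
  also have "\<dots> \<le> grammar_size G" unfolding grammar_size_def using new by (intro sum_mono) blast
  finally show ?thesis using that e(1) yield w by (auto simp: generates_def)
qed

text \<open>Makes the \<open>LEAST\<close> in \<open>g_rl\<close> meaningful. A single symbol is
  treated apart because a \<open>Concat\<close> rule needs two variables.\<close>

lemma rlslp_exists:
  assumes "w \<noteq> []"
  shows "\<exists>G. rlslp G \<and> generates G w"
proof (cases "length w = 1")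
  case True
  then obtain a where w: "w = [a]" by (cases w) auto
  define G where "G = \<lparr>rules = [0 \<mapsto> Terminal a], start = 0\<rparr>"
  have "rlslp G" by (auto simp: rlslp_def G_def)
  moreover have "derives G 0 [a]" by (rule derives.terminal) (simp add: G_def)
  ultimately show ?thesis by (auto simp: generates_def w G_def)
next
  case False
  define n where "n = length w"
  have n: "n > 1" using False assms by (cases w) (auto simp: n_def)
  define G where "G = \<lparr>rules = (\<lambda>A. if A < n then Some (Terminal (w ! A))
    else if A = n then Some (Concat [0..<n]) else None), start = n\<rparr>"
  have dom: "dom (rules G) = {..n}" by (auto simp: G_def dom_def)
  have "rlslp G" unfolding rlslp_def dom
    using n by (auto simp: G_def split: if_splits intro!: exI[of _ "\<lambda>x. x"])
  moreover have "derives G A [w ! A]" if "A < n" for A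
    using that by (intro derives.terminal) (simp add: G_def)
  then have "list_all2 (derives G) [0..<n] (map (\<lambda>A. [w ! A]) [0..<n])"
    by (simp add: list_all2_conv_all_nth)
  then have "derives G n (concat (map (\<lambda>A. [w ! A]) [0..<n]))"
    by (intro derives.concat[of G n "[0..<n]"]) (simp add: G_def)
  then have "generates G w"
    by (simp add: generates_def G_def n_def concat_map_singleton map_nth)
  ultimately show ?thesis by blast
qed

lemma g_rl_attained:
  assumes "w \<noteq> []"
  obtains G where "rlslp G" "generates G w" "grammar_size G = g_rl w"
proof -
  have "\<exists>g G. rlslp G \<and> generates G w \<and> grammar_size G = g"
    using rlslp_exists[OF assms] by blast
  from LeastI_ex[OF this] show ?thesis using that unfolding g_rl_def by blast
qed

subsection \<open>Normalisation and reversal\<close>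

text \<open>Besides the padding, exponents 0 and 1 are removed, so that the result is
  \<open>Emp\<close> or \<open>ok\<close> for every argument.\<close>

primrec norm_expr :: "'a expr \<Rightarrow> 'a expr" where
  "norm_expr Emp = Emp"
| "norm_expr (Chr a) = Chr a"
| "norm_expr (Cat x y) = (if norm_expr x = Emp then norm_expr y
     else if norm_expr y = Emp then norm_expr x else Cat (norm_expr x) (norm_expr y))"
| "norm_expr (Rep x t) = (if norm_expr x = Emp \<or> t = 0 then Emp
     else if t = 1 then norm_expr x else Rep (norm_expr x) t)"

lemma norm_expr_ok: "norm_expr x = Emp \<or> ok (norm_expr x)"
  by (induction x) auto

lemma yield_norm_expr: "yield (norm_expr x) = yield x"
proof (induction x)
  case (Cat x y)
  then show ?case by (auto simp: Cat.IH[symmetric])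
next
  case (Rep x t)
  then show ?case by (auto simp: Rep[symmetric])
qed auto

lemma height_norm_expr: "height (norm_expr x) \<le> height x"
  by (induction x) auto

text \<open>In this form it shows that normalisation cannot increase the number of distinct
  subexpressions.\<close>

lemma subs_norm_expr: "subs (norm_expr x) \<subseteq> norm_expr ` subs x"
proof (induction x)
  case (Cat x y)
  have "norm_expr (Cat x y) \<in> norm_expr ` subs (Cat x y)" by (intro imageI) simp
  with Cat show ?case by auto
next
  case (Rep x t)
  have "norm_expr (Rep x t) \<in> norm_expr ` subs (Rep x t)" by (intro imageI) simp
  with Rep show ?case by auto
qed auto

lemma balanced_expr:
  assumes "w \<noteq> []"
  obtains e where "ok e" "yield e = w" "card (subs e) \<le> 9 * g_rl w" "height e \<le> 25 * floor_log (length w)"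
proof -
  obtain G where "rlslp G" "generates G w" "grammar_size G = g_rl w" using g_rl_attained assms by blast
  then obtain r where r: "ok r" "yield r = w" "card (subs r) \<le> g_rl w" using rlslp_expr by metis
  interpret centroid r by unfold_locales (rule r(1))
  obtain e where e: "yield e = w" "card (subs e) \<le> 8 * card (subs r) + 1" "height e \<le> 25 * floor_log (length w)"
    using balance r(2) by auto
  have "yield (norm_expr e) = w" using e(1) by (simp add: yield_norm_expr)
  moreover from this have "ok (norm_expr e)" using assms norm_expr_ok[of e] by auto
  moreover have "card (subs (norm_expr e)) \<le> card (subs e)"
    using card_mono[OF _ subs_norm_expr[of e]] card_image_le[of "subs e" norm_expr] by simp
  \<comment> \<open>Absorbs the additive 1 of \<open>balance\<close> into the factor 9.\<close>
  moreover have "0 < card (subs r)" using self_subs[of r] by (auto simp: card_gt_0_iff simp del: self_subs)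
  ultimately show ?thesis
    using that[of "norm_expr e"] e r(3) height_norm_expr[of e] by auto
qed

primrec mirror :: "'a expr \<Rightarrow> 'a expr" where
  "mirror Emp = Emp"
| "mirror (Chr a) = Chr a"
| "mirror (Cat x y) = Cat (mirror y) (mirror x)"
| "mirror (Rep x t) = Rep (mirror x) t"

lemma yield_mirror: "yield (mirror x) = rev (yield x)"
  by (induction x) (auto simp: rev_concat map_replicate)

lemma ok_mirror: "ok (mirror x) = ok x"
  by (induction x) auto

lemma height_mirror: "height (mirror x) = height x"
  by (induction x) auto

lemma subs_mirror: "subs (mirror x) = mirror ` subs x"
  by (induction x) auto

text \<open>A parse tree with binary branching has fewer than twice as many nodes as leaves. The
  bound in terms of the length, not of \<open>g_rl\<close>, is what makes addresses fit into words
  of logarithmic length.\<close>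

lemma card_subs_le: "ok x \<Longrightarrow> card (subs x) < 2 * len x"
proof (induction x)
  case (Cat x y)
  then have "card (subs (Cat x y)) \<le> Suc (card (subs x) + card (subs y))"
    using card_Un_le[of "subs x" "subs y"] by (simp add: card_insert_if)
  with Cat show ?case by simp
next
  case (Rep x t)
  have "card (subs (Rep x t)) \<le> Suc (card (subs x))" by (simp add: card_insert_if)
  moreover have "2 * len x \<le> t * len x" using Rep.prems by (intro mult_right_mono) auto
  moreover have "card (subs x) < 2 * len x" "0 < len x" using Rep len_pos by auto
  ultimately have "card (subs (Rep x t)) < 2 * (t * len x)" by linarith
  then show ?case by simp
qed auto

subsection \<open>Searching in an expression\<close>

definition small_in :: "'a::linorder \<Rightarrow> 'a list \<Rightarrow> bool" where
  "small_in d xs \<longleftrightarrow> (\<exists>a\<in>set xs. a < d)"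

lemma small_in_append: "small_in d (xs @ ys) \<longleftrightarrow> small_in d xs \<or> small_in d ys"
  by (auto simp: small_in_def)

text \<open>The 1-based position of the last symbol below \<open>d\<close>, and 0 if there is none,
  which is the convention of \<open>psv'\<close>.\<close>

definition last_small :: "'a::linorder \<Rightarrow> 'a list \<Rightarrow> nat" where
  "last_small d xs = length (dropWhile (\<lambda>a. \<not> a < d) (rev xs))"

lemma last_small_append:
  "last_small d (xs @ ys) = (if small_in d ys then length xs + last_small d ys else last_small d xs)"
proof (cases "small_in d ys")
  case True
  then obtain a where "a \<in> set (rev ys)" "\<not> \<not> a < d" by (auto simp: small_in_def)
  then have "dropWhile (\<lambda>a. \<not> a < d) (rev ys @ rev xs) = dropWhile (\<lambda>a. \<not> a < d) (rev ys) @ rev xs"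
    by (rule dropWhile_append1)
  with True show ?thesis by (simp add: last_small_def)
next
  case False
  then have "dropWhile (\<lambda>a. \<not> a < d) (rev ys @ rev xs) = dropWhile (\<lambda>a. \<not> a < d) (rev xs)"
    by (intro dropWhile_append2) (auto simp: small_in_def)
  with False show ?thesis by (simp add: last_small_def)
qed

lemma last_small_none: "\<not> small_in d xs \<Longrightarrow> last_small d xs = 0"
  by (auto simp: last_small_def small_in_def dropWhile_eq_Nil_conv)

lemma last_small_Max:
  "Max ({j \<in> {1..length xs}. j \<le> p \<and> xs ! (j - 1) < d} \<union> {0}) = last_small d (take p xs)"
proof (induction p)
  case 0
  have "{j \<in> {1..length xs}. j \<le> 0 \<and> xs ! (j - 1) < d} = {}" by auto
  then show ?case by (simp only:) (simp add: last_small_def)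
next
  case (Suc p)
  show ?case
  proof (cases "p < length xs \<and> xs ! p < d")
    case True
    have "Max ({j \<in> {1..length xs}. j \<le> Suc p \<and> xs ! (j - 1) < d} \<union> {0}) = Suc p"
      using True by (intro Max_eqI) auto
    then show ?thesis using True
      by (simp add: take_Suc_conv_app_nth last_small_append small_in_def) (simp add: last_small_def)
  next
    case False
    have "{j \<in> {1..length xs}. j \<le> Suc p \<and> xs ! (j - 1) < d} =
        {j \<in> {1..length xs}. j \<le> p \<and> xs ! (j - 1) < d}"
      using False by (auto simp: le_Suc_eq)
    moreover have "last_small d (take (Suc p) xs) = last_small d (take p xs)"
      using False by (cases "p < length xs") (auto simp: take_Suc_conv_app_nth last_small_append small_in_def)
    ultimately show ?thesis using Suc by simp
  qed
qed

lemma psv'_last_small: "1 \<le> i \<Longrightarrow> psv' w i d = last_small d (take (i - 1) w)"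
proof -
  assume "1 \<le> i"
  then have "{j \<in> {1..length w}. j < i \<and> at_pos w j < d} = {j \<in> {1..length w}. j \<le> i - 1 \<and> w ! (j - 1) < d}"
    by (auto simp: at_pos_def)
  then show ?thesis unfolding psv'_def by (simp only: last_small_Max)
qed

text \<open>Reversal sends position \<open>j\<close> to \<open>n + 1 - j\<close>. This exchanges
  minimum and maximum, turns the default \<open>n + 1\<close> into 0, and makes the positions after
  \<open>i\<close> a prefix of length \<open>n - i\<close>.\<close>

lemma nsv'_last_small:
  assumes "1 \<le> i" "i \<le> length w"
  shows "nsv' w i d = length w + 1 - last_small d (take (length w - i) (rev w))"
proof -
  let ?n = "length w" and ?A = "{j \<in> {1..length w}. j > i \<and> at_pos w j < d}"
  let ?B = "{j \<in> {1..length (rev w)}. j \<le> length w - i \<and> rev w ! (j - 1) < d}"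
  have img: "?A \<union> {?n + 1} = (\<lambda>j. ?n + 1 - j) ` (?B \<union> {0})"
  proof (intro equalityI subsetI)
    fix x assume "x \<in> ?A \<union> {?n + 1}"
    then consider "x = ?n + 1" | "x \<in> ?A" by auto
    then show "x \<in> (\<lambda>j. ?n + 1 - j) ` (?B \<union> {0})"
    proof cases
      case 2
      then have "?n + 1 - x \<in> ?B" "x = ?n + 1 - (?n + 1 - x)"
        by (auto simp: rev_nth at_pos_def)
      then show ?thesis by blast
    qed auto
  next
    fix x assume "x \<in> (\<lambda>j. ?n + 1 - j) ` (?B \<union> {0})"
    then show "x \<in> ?A \<union> {?n + 1}"
      using assms by (auto simp: rev_nth at_pos_def)
  qed
  have m: "Max (?B \<union> {0}) \<in> ?B \<union> {0}" by (rule Max_in) auto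
  have "Min ((\<lambda>j. ?n + 1 - j) ` (?B \<union> {0})) = ?n + 1 - Max (?B \<union> {0})"
  proof (rule Min_eqI)
    fix y assume "y \<in> (\<lambda>j. ?n + 1 - j) ` (?B \<union> {0})"
    then obtain j where "j \<in> ?B \<union> {0}" "y = ?n + 1 - j" by blast
    moreover from this have "j \<le> Max (?B \<union> {0})" by (intro Max_ge) auto
    ultimately show "?n + 1 - Max (?B \<union> {0}) \<le> y" by (simp only: diff_le_mono2)
  qed (use m in auto)
  then show ?thesis
    unfolding nsv'_def img using last_small_Max[of "rev w" "length w - i" d] by simp
qed

primrec min_sym :: "'a::linorder expr \<Rightarrow> 'a" where
  "min_sym Emp = undefined"
| "min_sym (Chr a) = a"
| "min_sym (Cat x y) = min (min_sym x) (min_sym y)"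
| "min_sym (Rep x t) = min_sym x"

lemma min_sym_less: "ok x \<Longrightarrow> min_sym x < d \<longleftrightarrow> small_in d (yield x)"
  by (induction x) (auto simp: small_in_def min_less_iff_disj)

text \<open>\<open>Cat x y\<close> and \<open>Rep x t\<close> are treated alike: a node derives its left child once, followed by
  copies of its right child.\<close>

primrec left_child :: "'a expr \<Rightarrow> 'a expr" where
  "left_child Emp = Emp"
| "left_child (Chr a) = Emp"
| "left_child (Cat x y) = x"
| "left_child (Rep x t) = x"

primrec right_child :: "'a expr \<Rightarrow> 'a expr" where
  "right_child Emp = Emp"
| "right_child (Chr a) = Emp"
| "right_child (Cat x y) = y"
| "right_child (Rep x t) = x"

lemma height_children:
  "0 < height x \<Longrightarrow> height (left_child x) < height x \<and> height (right_child x) < height x"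
  by (cases x) auto

lemma children_subs:
  "0 < height x \<Longrightarrow> left_child x \<in> subs x \<and> right_child x \<in> subs x"
  by (cases x) auto

lemma height_0: "ok x \<Longrightarrow> height x = 0 \<Longrightarrow> \<exists>a. x = Chr a"
  by (cases x) auto

lemma take_left:
  assumes "ok x" "0 < height x" "p \<le> len (left_child x)"
  shows "take p (yield x) = take p (yield (left_child x))" "len (left_child x) \<le> len x"
proof -
  have "\<exists>ys. yield x = yield (left_child x) @ ys"
  proof (cases x)
    case (Rep a t)
    then obtain j where "t = Suc j" using assms(1) by (cases t) auto
    then show ?thesis using Rep by simp
  qed (use assms in auto)
  with assms(3) show "take p (yield x) = take p (yield (left_child x))" "len (left_child x) \<le> len x"
    by auto
qed

text \<open>In a power, the last complete copy inside the prefix acts as the left child, the copy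
  after it as the right child, and \<open>s\<close> is the length of the copies skipped before both.
  The skipped part \<open>zs\<close> has only symbols of the left child, so it never holds the last
  small symbol. The \<open>- 1\<close> puts a prefix that ends at a copy boundary at the end of a
  copy, so that \<open>q\<close> is never 0; for \<open>Cat\<close> it gives
  \<open>s = 0\<close>.\<close>

lemma take_right:
  assumes "ok x" "0 < height x" "len (left_child x) < p" "p \<le> len x"
  defines "l \<equiv> len (left_child x)" and "m \<equiv> len (right_child x)"
  defines "s \<equiv> (p - l - 1) div m * m"
  defines "q \<equiv> p - l - s"
  shows "0 < m" "s + l < p" "1 \<le> q" "q \<le> m" "s + l + m \<le> len x" "q = (p - l - 1) mod m + 1"
    "\<exists>zs. set zs \<subseteq> set (yield (left_child x)) \<and> length zs = s \<and>
       take p (yield x) = zs @ yield (left_child x) @ take q (yield (right_child x))"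
proof -
  have okc: "ok (right_child x)" using assms(1,2) by (cases x) auto
  then show m: "0 < m" unfolding m_def by (rule len_pos)
  define k where "k = (p - l - 1) div m"
  have s: "s = k * m" by (simp add: s_def k_def)
  have dm: "p - l - 1 = s + (p - l - 1) mod m" by (simp add: s_def)
  have lp: "l < p" using assms(3) by (simp add: l_def)
  show sl: "s + l < p" using dm lp by linarith
  show q: "q = (p - l - 1) mod m + 1" using dm lp sl unfolding q_def by linarith
  then show q1: "1 \<le> q" by simp
  have "(p - l - 1) mod m < m" using m by simp
  then show qm: "q \<le> m" using q by simp
  have pq: "p = s + l + q" using sl unfolding q_def by linarith
  show "s + l + m \<le> len x"
  proof (cases x)
    case (Cat a b)
    then have "p - l - 1 < m" using assms(4) lp by (simp add: l_def m_def)
    then have "s = 0" by (simp add: s_def)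
    then show ?thesis using Cat by (simp add: l_def m_def)
  next
    case (Rep a t)
    then have lm: "l = m" "len x = t * m" by (simp_all add: l_def m_def)
    have "Suc k * m < t * m" using pq q1 s lm assms(4) by simp
    then have "Suc (Suc k) \<le> t" by (simp only: mult_less_cancel2 Suc_le_eq)
    then have "Suc (Suc k) * m \<le> t * m" by (rule mult_right_mono) simp
    then show ?thesis using lm s by simp
  qed (use assms(2) in auto)
  show "\<exists>zs. set zs \<subseteq> set (yield (left_child x)) \<and> length zs = s \<and>
       take p (yield x) = zs @ yield (left_child x) @ take q (yield (right_child x))"
  proof (cases x)
    case (Cat a b)
    then have "p - l - 1 < m" using assms(4) lp by (simp add: l_def m_def)
    then have "s = 0" by (simp add: s_def)
    then show ?thesis using Cat pq by (intro exI[of _ "[]"]) (simp add: l_def)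
  next
    case (Rep a t)
    then have lm: "l = m" "len x = t * m" "len a = m" by (simp_all add: l_def m_def)
    have "Suc k * m < t * m" using pq q1 s lm assms(4) by simp
    then have "Suc k < t" by (simp only: mult_less_cancel2)
    then obtain j where t: "t = k + Suc (Suc j)" using less_iff_Suc_add by auto
    have "yield x = concat (replicate k (yield a)) @ yield a @ yield a @ concat (replicate j (yield a))"
      by (simp only: Rep t yield.simps replicate_add replicate_Suc concat_append concat.simps)
    moreover have lz: "length (concat (replicate k (yield a))) = s" using lm s by simp
    ultimately have "take p (yield x) = concat (replicate k (yield a)) @ yield a @ take q (yield a)"
      using lm qm by (simp add: pq)
    then show ?thesis using Rep lz
      by (intro exI[of _ "concat (replicate k (yield a))"]) auto
  qed (use assms(2) in auto)
qed

subsection \<open>The program\<close>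

text \<open>Working cells: 0 argument and result, 1 the symbol \<open>d\<close>, 2 current node, 3 length \<open>p\<close> of the
  prefix of the current node to be searched, 4 offset of the current node, 5 and 6 node and offset
  of the rightmost node left behind that contains a small symbol (node 0 if there is none), 7 and 8
  the constants 1 and 0, 9 set if the string is reversed, 10 then contains \<open>n + 1\<close>; the rest is
  scratch. A node occupies four cells: its least symbol, its length, its left child (0 for a leaf)
  and its right child. Cells 0 and 1 of the index point to the roots for the string and its reversal.\<close>

definition code :: "instr list" where
  "code = [
    \<comment> \<open>1: search loop\<close>
    Read 11 2, JumpLess 11 1 11,
    JumpLess 8 5 6, Const 0 0, Jump 41,
    Move 2 5, Move 4 6, Arith Add 12 2 7, Read 3 12, Jump 1,
    \<comment> \<open>11: the current node contains a small symbol\<close>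
    Arith Add 12 2 7, Arith Add 12 12 7, Read 13 12, JumpLess 8 13 17,
    Arith Add 0 4 7, Jump 41,
    Arith Add 14 13 7, Read 14 14, JumpLess 14 3 22,
    Move 2 13, Jump 1,
    \<comment> \<open>22: into a copy of the right child\<close>
    Arith Add 12 12 7, Read 15 12, Arith Add 16 15 7, Read 16 16,
    Arith Sub 17 3 14, Arith Sub 17 17 7, Arith Div 17 17 16, Arith Mul 17 17 16, Arith Add 18 4 17,
    Read 19 13, JumpLess 19 1 34, Jump 36, Move 5 13, Move 6 18,
    Arith Add 4 18 14, Arith Sub 3 3 14, Arith Sub 3 3 17, Move 2 15, Jump 1,
    \<comment> \<open>41: exit\<close>
    JumpLess 8 9 43, Halt, Arith Sub 0 10 0, Halt,
    \<comment> \<open>45: \<open>psv'\<close>\<close>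
    Const 7 1, Read 2 8, Arith Sub 3 0 7, JumpLess 8 3 1, Const 0 0, Jump 41,
    \<comment> \<open>51: \<open>nsv'\<close>\<close>
    Const 7 1, Const 9 1, Read 2 7, Arith Add 11 2 7, Read 10 11, Arith Sub 3 10 0,
    Arith Add 10 10 7, JumpLess 8 3 1, Const 0 0, Jump 41,
    \<comment> \<open>61: \<open>psv\<close>; 63: \<open>nsv\<close>\<close>
    Const 7 1, Jump 65, Const 7 1, Const 9 1, Read 2 8, Move 3 0,
    \<comment> \<open>67: random access\<close>
    Arith Add 12 2 7, Arith Add 12 12 7, Read 13 12, JumpLess 8 13 74,
    Read 1 2, JumpLess 8 9 51, Jump 45,
    Arith Add 14 13 7, Read 14 14, JumpLess 14 3 79, Move 2 13, Jump 67,
    Arith Add 12 12 7, Read 15 12, Arith Add 16 15 7, Read 16 16,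
    Arith Sub 17 3 14, Arith Sub 17 17 7, Arith Mod 3 17 16, Arith Add 3 3 7, Move 2 15, Jump 67]"

text \<open>The four queries share one code and differ only in the entry point. The jump takes
  position 0, so labels in \<open>code\<close> count from 1.\<close>

definition prog :: "nat \<Rightarrow> instr list" where
  "prog entry = Jump entry # code"

section \<open>Symbolic execution of the program\<close>

lemma exec_mono: "exec b M P t c = Some v \<Longrightarrow> t \<le> t' \<Longrightarrow> exec b M P t' c = Some v"
proof (induction t arbitrary: t' c)
  case (Suc t)
  obtain pc R where c: "c = (pc, R)" by force
  obtain u where "t' = Suc u" "t \<le> u" using Suc.prems(2) by (cases t') auto
  with Suc show ?case unfolding c by (auto split: if_splits option.splits)
qed simp

lemma exec_num:
  "exec b M P (numeral k + t) (pc, R) =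
     (if pc \<ge> length P then None
      else if P ! pc = Halt then Some (R 0)
      else case step b M (P ! pc) (pc, R) of
             Some c' \<Rightarrow> exec b M P (pred_numeral k + t) c'
           | None \<Rightarrow> None)"
  by (simp add: numeral_eq_Suc)

text \<open>Stopping at the loop heads, at the exit and after random access keeps symbolic execution by the
  simplifier finite.\<close>

lemma exec_run:
  "pc \<notin> {1, 41, 67, 72} \<Longrightarrow> exec b M P (numeral k + t) (pc, R) =
     (if pc \<ge> length P then None
      else if P ! pc = Halt then Some (R 0)
      else case step b M (P ! pc) (pc, R) of
             Some c' \<Rightarrow> exec b M P (pred_numeral k + t) c'
           | None \<Rightarrow> None)"
  by (rule exec_num)

lemma length_prog: "length (prog entry) = 89"
  by (simp add: prog_def code_def)

text \<open>A single equation between lists, from which \<open>prog_nth\<close> obtains one rewrite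
  rule per instruction.\<close>

lemma prog_upt: "map ((!) (prog entry)) [2..<89] = drop 1 code"
proof -
  have "map ((!) (prog entry)) [2..<89] = drop 2 (map ((!) (prog entry)) [0..<length (prog entry)])"
    by (simp only: drop_map drop_upt length_prog add_0)
  then show ?thesis by (simp only: map_nth) (simp add: prog_def numeral_2_eq_2)
qed

lemma prog_0_1: "prog entry ! 0 = Jump entry" "prog entry ! Suc 0 = Read 11 2"
  by (simp_all add: prog_def code_def)

lemmas prog_nth = prog_0_1 prog_upt[simplified code_def upt_rec_numeral, simplified]
  length_prog numeral_2_eq_2[symmetric]

lemma sub_word:
  assumes "y \<le> x" "x < 2 ^ b"
  shows "(2 ^ b + x - y) mod 2 ^ b = (x - y :: nat)"
proof -
  have "2 ^ b + x - y = 2 ^ b + (x - y)" using assms(1) by (rule diff_add_assoc)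
  moreover have "(x - y) mod 2 ^ b = x - y"
    using assms(2) by (intro mod_less less_imp_diff_less)
  ultimately show ?thesis by (simp only: mod_add_self1)
qed

section \<open>Correctness of the search loop\<close>

locale index =
  fixes b n :: nat and M :: "'a::linorder cell list" and E :: "'a expr set" and ad :: "'a expr \<Rightarrow> nat"
    and entry :: nat
  assumes ok_E: "x \<in> E \<Longrightarrow> ok x"
    and closed_E: "x \<in> E \<Longrightarrow> subs x \<subseteq> E"
    and ad_pos: "x \<in> E \<Longrightarrow> 0 < ad x"
    and ad_less: "x \<in> E \<Longrightarrow> ad x + 3 < length M"
    and length_M: "length M < 2 ^ b"
    and n_less: "n + 1 < 2 ^ b"
    and M_min: "x \<in> E \<Longrightarrow> M ! ad x = Sym (min_sym x)"
    and M_len: "x \<in> E \<Longrightarrow> M ! Suc (ad x) = Word (len x)"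
    and M_left: "x \<in> E \<Longrightarrow> M ! Suc (Suc (ad x)) = Word (if height x = 0 then 0 else ad (left_child x))"
    and M_right: "x \<in> E \<Longrightarrow> M ! Suc (Suc (Suc (ad x))) = Word (if height x = 0 then 0 else ad (right_child x))"
begin

abbreviation run :: "nat \<Rightarrow> nat \<times> (nat \<Rightarrow> 'a cell) \<Rightarrow> 'a cell option" where
  "run \<equiv> exec b M (prog entry)"

definition fallback :: "'a \<Rightarrow> (nat \<Rightarrow> 'a cell) \<Rightarrow> ('a expr \<times> nat) option \<Rightarrow> bool" where
  "fallback d R fb \<longleftrightarrow> (case fb of None \<Rightarrow> R 5 = Word 0
     | Some (f, fo) \<Rightarrow> R 5 = Word (ad f) \<and> R 6 = Word fo \<and> f \<in> E \<and> min_sym f < d \<and> fo + len f \<le> n)"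

text \<open>The invariant at label 1. Keeping the current node within the first \<open>n\<close>
  positions rules out overflow when offsets are added.\<close>

definition state ::
  "nat \<Rightarrow> 'a \<Rightarrow> (nat \<Rightarrow> 'a cell) \<Rightarrow> 'a expr \<Rightarrow> nat \<Rightarrow> nat \<Rightarrow> ('a expr \<times> nat) option \<Rightarrow> bool" where
  "state fl d R x p off fb \<longleftrightarrow> x \<in> E \<and> R 1 = Sym d \<and> R 2 = Word (ad x) \<and> R 3 = Word p \<and> R 4 = Word off \<and>
     R 7 = Word 1 \<and> R 8 = Word 0 \<and> R 9 = Word fl \<and> (0 < fl \<longrightarrow> R 10 = Word (n + 1)) \<and>
     1 \<le> p \<and> p \<le> len x \<and> off + len x \<le> n \<and> fallback d R fb"

definition result :: "nat \<Rightarrow> nat \<Rightarrow> nat" where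
  "result fl v = (if fl = 0 then v else n + 1 - v)"

lemma fallback_upd: "k \<noteq> 5 \<Longrightarrow> k \<noteq> 6 \<Longrightarrow> fallback d (R(k := c)) fb = fallback d R fb"
  by (simp add: fallback_def split: option.split)

lemma exit:
  assumes "R 0 = Word v" "R 8 = Word 0" "R 9 = Word fl" "0 < fl \<longrightarrow> R 10 = Word (n + 1)" "v \<le> n"
  shows "run (3 + t) (41, R) = Some (Word (result fl v))"
  apply (subst exec_num)
  using assms n_less sub_word[of v "n + 1" b]
  apply (cases "fl = 0"; simp add: exec_run prog_nth result_def)
  done

lemma child_E:
  assumes "x \<in> E" "0 < height x"
  shows "left_child x \<in> E" "right_child x \<in> E"
  using children_subs[OF assms(2)] closed_E[OF assms(1)] by auto

text \<open>Here and below, 45 is a generous uniform budget for one pass through the loop;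
  \<open>exec_mono\<close> discards what is left of it.\<close>

lemma step_none:
  assumes "state fl d R x p off None" "\<not> min_sym x < d"
  shows "run (45 + t) (1, R) = Some (Word (result fl 0))"
  apply (subst exec_num)
  using assms ad_less[of x] M_min[of x]
  apply (simp add: exec_run prog_nth state_def fallback_def)
  apply (rule exec_mono[OF exit[where t = 0]]; simp)
  done

lemma step_fallback:
  assumes "state fl d R x p off (Some (f, fo))" "\<not> min_sym x < d"
    "\<And>R'. state fl d R' f (len f) fo (Some (f, fo)) \<Longrightarrow> run t (1, R') = Some v"
  shows "run (45 + t) (1, R) = Some v"
proof -
  have f: "f \<in> E" using assms(1) by (auto simp: state_def fallback_def)
  have "0 < len f" using len_pos ok_E f by blast
  then show ?thesis
    apply (subst exec_num)
    using assms(1,2) ad_less[of x] M_min[of x] ad_pos[OF f] ad_less[OF f] M_len[OF f] length_M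
    apply (simp add: exec_run prog_nth state_def fallback_def)
    apply (rule exec_mono[OF assms(3)[unfolded One_nat_def]])
     apply (simp add: state_def fallback_def Suc_le_eq)
    apply simp
    done
qed

lemma step_leaf:
  assumes "state fl d R (Chr a) p off fb" "a < d"
  shows "run (45 + t) (1, R) = Some (Word (result fl (off + 1)))"
  apply (subst exec_num)
  using assms ad_less[of "Chr a"] M_min[of "Chr a"] M_left[of "Chr a"] length_M n_less
  apply (simp add: exec_run prog_nth state_def)
  apply (rule exec_mono[OF exit[where t = 0 and v = "Suc off"]]; simp)
  done

lemma step_left:
  assumes "state fl d R x p off fb" "min_sym x < d" "0 < height x" "p \<le> len (left_child x)"
    "\<And>R'. state fl d R' (left_child x) p off fb \<Longrightarrow> run t (1, R') = Some v"
  shows "run (45 + t) (1, R) = Some v"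
proof -
  have x: "x \<in> E" using assms(1) by (auto simp: state_def)
  note l = child_E(1)[OF x assms(3)]
  note M = ad_less[OF x] M_min[OF x] M_left[OF x] ad_pos[OF l] ad_less[OF l] M_len[OF l]
  show ?thesis
    apply (subst exec_num)
    using assms(1-4) M length_M
    apply (simp add: exec_run prog_nth state_def)
    apply (rule exec_mono[OF assms(5)[unfolded One_nat_def]])
     apply (use take_left(2)[OF ok_E[OF x] assms(3,4)] in
        \<open>simp add: state_def l fallback_upd\<close>)
    apply simp
    done
qed

lemma step_right:
  assumes "state fl d R x p off fb" "min_sym x < d" "0 < height x" "len (left_child x) < p"
  defines "s \<equiv> (p - len (left_child x) - 1) div len (right_child x) * len (right_child x)"
  assumes nxt: "\<And>R'. state fl d R' (right_child x) (p - len (left_child x) - s) (off + s + len (left_child x))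
      (if min_sym (left_child x) < d then Some (left_child x, off + s) else fb) \<Longrightarrow> run t (1, R') = Some v"
  shows "run (45 + t) (1, R) = Some v"
proof -
  have x: "x \<in> E" and p: "p \<le> len x" and n: "off + len x \<le> n" using assms(1) by (auto simp: state_def)
  note l = child_E(1)[OF x assms(3)] and r = child_E(2)[OF x assms(3)]
  note M = ad_less[OF x] M_min[OF x] M_left[OF x] M_right[OF x] ad_pos[OF l] ad_less[OF l] M_len[OF l]
    M_min[OF l] ad_pos[OF r] ad_less[OF r] M_len[OF r]
  note tr = take_right(1-5)[OF ok_E[OF x] assms(3,4) p, folded s_def]
  show ?thesis
  proof (cases "min_sym (left_child x) < d")
    case True
    show ?thesis
      apply (subst exec_num)
      using assms(1-4) M length_M n_less True tr n
      apply (simp add: exec_run prog_nth state_def sub_word s_def)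
      apply (rule exec_mono[OF nxt[unfolded One_nat_def s_def]])
       apply (use tr n True in \<open>simp add: state_def fallback_def r l s_def\<close>)
      apply simp
      done
  next
    case False
    show ?thesis
      apply (subst exec_num)
      using assms(1-4) M length_M n_less False tr n
      apply (simp add: exec_run prog_nth state_def sub_word s_def)
      apply (rule exec_mono[OF nxt[unfolded One_nat_def s_def]])
       apply (use tr n False in \<open>simp add: state_def fallback_upd r s_def\<close>)
      apply simp
      done
  qed
qed

text \<open>A search of a whole node starts with its right child. If that holds no small symbol, the
  left child just remembered must hold one, so a wrong turn is repaired by the next pass: two passes
  per level.\<close>

lemma search_full:
  assumes "state fl d R x (len x) off fb" "min_sym x < d"
  shows "run (45 * (2 * height x + 1)) (1, R) = Some (Word (result fl (off + last_small d (yield x))))"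
  using assms
proof (induction "height x" arbitrary: x R off fb rule: less_induct)
  case less
  have x: "x \<in> E" using less.prems by (simp add: state_def)
  note ok = ok_E[OF x]
  show ?case
  proof (cases "height x = 0")
    case True
    then obtain a where a: "x = Chr a" using height_0 ok by blast
    have "run (45 + 0) (1, R) = Some (Word (result fl (off + 1)))"
      using less.prems unfolding a by (intro step_leaf) auto
    then show ?thesis using less.prems(2) by (simp add: a last_small_def)
  next
    case False
    then have h: "0 < height x" by simp
    let ?l = "left_child x" and ?r = "right_child x"
    note l = child_E(1)[OF x h] and r = child_E(2)[OF x h] and hc = height_children[OF h]
    define s where "s = (len x - len ?l - 1) div len ?r * len ?r"
    define q where "q = len x - len ?l - s"
    have lt: "len ?l < len x" using ok h len_pos ok_E[OF l] ok_E[OF r]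
      by (cases x) (auto simp: Suc_le_eq)
    note tr = take_right[OF ok h lt order_refl, folded s_def, folded q_def]
    obtain zs where zs: "set zs \<subseteq> set (yield ?l)" "length zs = s"
      "take (len x) (yield x) = zs @ yield ?l @ take q (yield ?r)"
      using tr(7) by blast
    have q: "q = len ?r" using tr(2,4,5) unfolding q_def by linarith
    then have y: "yield x = zs @ yield ?l @ yield ?r" using zs(3) by simp
    have sml: "small_in d (yield ?l) \<longleftrightarrow> min_sym ?l < d" "small_in d (yield ?r) \<longleftrightarrow> min_sym ?r < d"
      using min_sym_less ok_E l r by blast+
    have "run (45 + (45 * (2 * height x))) (1, R) =
      Some (Word (result fl (off + last_small d (yield x))))"
    proof (rule step_right[OF less.prems h lt], fold s_def, fold q_def)
      fix R' assume st: "state fl d R' ?r q (off + s + len ?l)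
        (if min_sym ?l < d then Some (?l, off + s) else fb)"
      show "run (45 * (2 * height x)) (1, R') = Some (Word (result fl (off + last_small d (yield x))))"
      proof (cases "min_sym ?r < d")
        case True
        have "run (45 * (2 * height ?r + 1)) (1, R') =
            Some (Word (result fl (off + s + len ?l + last_small d (yield ?r))))"
          using less.hyps[of ?r R'] st True hc unfolding q by blast
        then have "run (45 * (2 * height x)) (1, R') =
            Some (Word (result fl (off + s + len ?l + last_small d (yield ?r))))"
          by (rule exec_mono) (use hc in simp)
        then show ?thesis using True sml zs(2) by (simp add: y last_small_append small_in_append add.assoc)
      next
        case nr: False
        have "min_sym x < d" by fact
        then have "small_in d (yield x)" using min_sym_less ok by blast
        with y zs(1) nr sml have "min_sym ?l < d" by (auto simp: small_in_def)
        with st have st': "state fl d R' ?r q (off + s + len ?l) (Some (?l, off + s))" by simp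
        have "run (45 + 45 * (2 * height ?l + 1)) (1, R') =
            Some (Word (result fl (off + s + last_small d (yield ?l))))"
          using less.hyps[of ?l] hc \<open>min_sym ?l < d\<close> by (intro step_fallback[OF st' nr]) blast
        then have "run (45 * (2 * height x)) (1, R') =
            Some (Word (result fl (off + s + last_small d (yield ?l))))"
          by (rule exec_mono) (use hc in simp)
        then show ?thesis using nr sml \<open>min_sym ?l < d\<close> zs(2)
          by (simp add: y last_small_append add.assoc small_in_append)
      qed
    qed
    then show ?thesis by simp
  qed
qed

definition found :: "'a \<Rightarrow> 'a expr \<Rightarrow> nat \<Rightarrow> nat \<Rightarrow> ('a expr \<times> nat) option \<Rightarrow> nat" where
  "found d x p off fb = (if small_in d (take p (yield x)) then off + last_small d (take p (yield x))
     else case fb of None \<Rightarrow> 0 | Some (f, fo) \<Rightarrow> fo + last_small d (yield f))"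

text \<open>One pass for each level of the descent, one for the restart, and
  \<open>2 * H + 1\<close> for the full search of the remembered node.\<close>

lemma search:
  assumes "state fl d R x p off fb" "height x \<le> H" "\<And>f fo. fb = Some (f, fo) \<Longrightarrow> height f \<le> H"
  shows "run (45 * (height x + 2 * H + 2)) (1, R) = Some (Word (result fl (found d x p off fb)))"
  using assms
proof (induction "height x" arbitrary: x R p off fb rule: less_induct)
  case less
  have x: "x \<in> E" and p: "1 \<le> p" "p \<le> len x" using less.prems by (auto simp: state_def)
  note ok = ok_E[OF x]
  show ?case
  proof (cases "min_sym x < d")
    case False
    then have "\<not> small_in d (yield x)" using min_sym_less ok by blast
    then have ns: "\<not> small_in d (take p (yield x))" by (auto simp: small_in_def dest: in_set_takeD)
    show ?thesis
    proof (cases fb)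
      case None
      have "run (45 + 45 * (height x + 2 * H + 1)) (1, R) = Some (Word (result fl 0))"
        by (rule step_none) (use less.prems(1) None False in simp_all)
      then show ?thesis using ns None by (simp add: found_def)
    next
      case (Some ffo)
      obtain f fo where ffo: "ffo = (f, fo)" by force
      have "run (45 + 45 * (2 * height f + 1)) (1, R) =
          Some (Word (result fl (fo + last_small d (yield f))))"
      proof (rule step_fallback[OF less.prems(1)[unfolded Some ffo] False])
        fix R' assume "state fl d R' f (len f) fo (Some (f, fo))"
        then show "run (45 * (2 * height f + 1)) (1, R') =
            Some (Word (result fl (fo + last_small d (yield f))))"
          by (rule search_full) (use less.prems(1) in \<open>simp add: state_def fallback_def Some ffo\<close>)
      qed
      then have "run (45 * (height x + 2 * H + 2)) (1, R) =
          Some (Word (result fl (fo + last_small d (yield f))))"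
        by (rule exec_mono) (use less.prems(3)[of f fo] Some ffo in simp)
      then show ?thesis using ns by (simp add: found_def Some ffo)
    qed
  next
    case True
    show ?thesis
    proof (cases "height x = 0")
      case h: True
      then obtain a where a: "x = Chr a" using height_0 ok by blast
      have "run (45 + 45 * (2 * H + 1)) (1, R) = Some (Word (result fl (off + 1)))"
        using less.prems(1) True unfolding a by (intro step_leaf) auto
      then show ?thesis using True p by (simp add: a found_def small_in_def last_small_def)
    next
      case False
      then have h: "0 < height x" by simp
      let ?l = "left_child x" and ?r = "right_child x"
      note l = child_E(1)[OF x h] and r = child_E(2)[OF x h] and hc = height_children[OF h]
      have "run (45 + 45 * (height x + 2 * H + 1)) (1, R) = Some (Word (result fl (found d x p off fb)))"
      proof (cases "p \<le> len ?l")
        case pl: True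
        show ?thesis
        proof (rule step_left[OF less.prems(1) True h pl])
          fix R' assume "state fl d R' ?l p off fb"
          then have "run (45 * (height ?l + 2 * H + 2)) (1, R') = Some (Word (result fl (found d ?l p off fb)))"
            using less.prems(2,3) hc by (intro less.hyps) auto
          moreover have "found d ?l p off fb = found d x p off fb"
            using take_left(1)[OF ok h pl] by (simp add: found_def)
          ultimately show "run (45 * (height x + 2 * H + 1)) (1, R') = Some (Word (result fl (found d x p off fb)))"
            using hc by (auto elim!: exec_mono)
        qed
      next
        case False
        then have lt: "len ?l < p" by simp
        define s where "s = (p - len ?l - 1) div len ?r * len ?r"
        define q where "q = p - len ?l - s"
        obtain zs where zs: "set zs \<subseteq> set (yield ?l)" "length zs = s"
          "take p (yield x) = zs @ yield ?l @ take q (yield ?r)"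
          using take_right(7)[OF ok h lt p(2), folded s_def, folded q_def] by blast
        let ?fb = "if min_sym ?l < d then Some (?l, off + s) else fb"
        have sml: "small_in d (yield ?l) \<longleftrightarrow> min_sym ?l < d"
          using min_sym_less ok_E l by blast
        \<comment> \<open>If the prefix of the right child fails, the left child at
          \<open>off + s\<close> is the rightmost candidate. If that has no small symbol either,
          neither has \<open>zs\<close>, and the old candidate stays valid.\<close>
        have f: "found d ?r q (off + s + len ?l) ?fb = found d x p off fb"
        proof (cases "small_in d (take q (yield ?r))")
          case True
          then show ?thesis using zs(2)
            by (simp add: found_def zs(3) last_small_append) (auto simp: small_in_def)
        next
          case nr: False
          show ?thesis
          proof (cases "min_sym ?l < d")
            case True
            then have "small_in d (take p (yield x))" using sml by (auto simp: zs(3) small_in_def)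
            then show ?thesis using nr True sml zs(2)
              by (simp add: found_def zs(3) last_small_append) (auto simp: small_in_def)
          next
            case False
            then have "\<not> small_in d (take p (yield x))" using nr zs(1) sml
              by (auto simp: zs(3) small_in_def)
            then show ?thesis using nr False by (simp add: found_def)
          qed
        qed
        show ?thesis
        proof (rule step_right[OF less.prems(1) True h lt], fold s_def, fold q_def)
          fix R' assume "state fl d R' ?r q (off + s + len ?l) ?fb"
          then have "run (45 * (height ?r + 2 * H + 2)) (1, R') =
              Some (Word (result fl (found d ?r q (off + s + len ?l) ?fb)))"
            using less.prems(2,3) hc by (intro less.hyps) (auto split: if_splits)
          then show "run (45 * (height x + 2 * H + 1)) (1, R') = Some (Word (result fl (found d x p off fb)))"
            unfolding f by (rule exec_mono) (use hc in simp)
        qed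
      qed
      then show ?thesis by simp
    qed
  qed
qed

section \<open>Random access\<close>

definition access_state :: "(nat \<Rightarrow> 'a cell) \<Rightarrow> (nat \<Rightarrow> 'a cell) \<Rightarrow> 'a expr \<Rightarrow> nat \<Rightarrow> bool" where
  "access_state R0 R x p \<longleftrightarrow> x \<in> E \<and> R 2 = Word (ad x) \<and> R 3 = Word p \<and> R 7 = Word 1 \<and> R 8 = Word 0 \<and>
     1 \<le> p \<and> p \<le> len x \<and> len x \<le> n \<and> (\<forall>k\<in>{0, 4, 5, 9}. R k = R0 k)"

lemma access_leaf:
  assumes "access_state R0 R (Chr a) p"
    "\<And>R'. R' 1 = Sym a \<Longrightarrow> R' 7 = Word 1 \<Longrightarrow> R' 8 = Word 0 \<Longrightarrow> (\<forall>k\<in>{0, 4, 5, 9}. R' k = R0 k) \<Longrightarrow>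
      run t (72, R') = Some v"
  shows "run (25 + t) (67, R) = Some v"
  apply (subst exec_num)
  using assms(1) ad_less[of "Chr a"] M_min[of "Chr a"] M_left[of "Chr a"] length_M
  apply (simp add: exec_run prog_nth access_state_def)
  apply (rule exec_mono[OF assms(2)[unfolded One_nat_def]]; simp)
  done

lemma access_left:
  assumes "access_state R0 R x p" "0 < height x" "p \<le> len (left_child x)"
    "\<And>R'. access_state R0 R' (left_child x) p \<Longrightarrow> run t (67, R') = Some v"
  shows "run (25 + t) (67, R) = Some v"
proof -
  have x: "x \<in> E" using assms(1) by (auto simp: access_state_def)
  note l = child_E(1)[OF x assms(2)]
  note M = ad_less[OF x] M_min[OF x] M_left[OF x] ad_pos[OF l] ad_less[OF l] M_len[OF l]
  show ?thesis
    apply (subst exec_num)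
    using assms(1-3) M length_M
    apply (simp add: exec_run prog_nth access_state_def)
    apply (rule exec_mono[OF assms(4)[unfolded One_nat_def]])
     apply (use take_left(2)[OF ok_E[OF x] assms(2,3)] in \<open>simp add: access_state_def l\<close>)
    apply simp
    done
qed

lemma access_right:
  assumes "access_state R0 R x p" "0 < height x" "len (left_child x) < p"
    "\<And>R'. access_state R0 R' (right_child x) ((p - len (left_child x) - 1) mod len (right_child x) + 1) \<Longrightarrow>
      run t (67, R') = Some v"
  shows "run (25 + t) (67, R) = Some v"
proof -
  have x: "x \<in> E" and p: "p \<le> len x" "len x \<le> n" using assms(1) by (auto simp: access_state_def)
  note l = child_E(1)[OF x assms(2)] and r = child_E(2)[OF x assms(2)]
  note M = ad_less[OF x] M_min[OF x] M_left[OF x] M_right[OF x] ad_pos[OF l] ad_less[OF l] M_len[OF l]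
    ad_pos[OF r] ad_less[OF r] M_len[OF r]
  note tr = take_right(1-6)[OF ok_E[OF x] assms(2,3) p(1)]
  have m: "len (right_child x) \<le> n" using tr(5) p(2) by linarith
  have q: "Suc ((p - Suc (len (left_child x))) mod len (right_child x)) \<le> len (right_child x)"
    using tr(1) by (simp add: Suc_le_eq)
  have q': "Suc ((p - Suc (len (left_child x))) mod len (right_child x)) mod 2 ^ b =
      Suc ((p - Suc (len (left_child x))) mod len (right_child x))"
    by (rule mod_less) (use q m n_less in linarith)
  show ?thesis
    apply (subst exec_num)
    using assms(1-3) M length_M n_less p tr(1) m
    apply (simp add: exec_run prog_nth access_state_def sub_word q')
    apply (rule exec_mono[OF assms(4)[unfolded One_nat_def]])
     apply (use m in \<open>simp add: access_state_def r q'\<close>)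
     apply (rule q)
    apply simp
    done
qed

lemma access:
  assumes "access_state R0 R x p"
    "\<And>R'. R' 1 = Sym (last (take p (yield x))) \<Longrightarrow> R' 7 = Word 1 \<Longrightarrow> R' 8 = Word 0 \<Longrightarrow>
      (\<forall>k\<in>{0, 4, 5, 9}. R' k = R0 k) \<Longrightarrow> run t (72, R') = Some v"
  shows "run (25 * (height x + 1) + t) (67, R) = Some v"
  using assms
proof (induction "height x" arbitrary: x R p rule: less_induct)
  case less
  have x: "x \<in> E" and p: "1 \<le> p" "p \<le> len x" using less.prems(1) by (auto simp: access_state_def)
  note ok = ok_E[OF x]
  show ?case
  proof (cases "height x = 0")
    case True
    then obtain a where a: "x = Chr a" using height_0 ok by blast
    have "run (25 + t) (67, R) = Some v"
      by (rule access_leaf[OF less.prems(1)[unfolded a]]) (use less.prems(2) p in \<open>simp add: a\<close>)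
    then show ?thesis by (simp add: a)
  next
    case False
    then have h: "0 < height x" by simp
    let ?l = "left_child x" and ?r = "right_child x"
    note hc = height_children[OF h]
    have "run (25 + (25 * height x + t)) (67, R) = Some v"
    proof (cases "p \<le> len ?l")
      case True
      show ?thesis
      proof (rule access_left[OF less.prems(1) h True])
        fix R' assume "access_state R0 R' ?l p"
        then have "run (25 * (height ?l + 1) + t) (67, R') = Some v"
          using hc take_left(1)[OF ok h True] less.prems(2) by (intro less.hyps) auto
        then show "run (25 * height x + t) (67, R') = Some v"
          by (rule exec_mono) (use hc in simp)
      qed
    next
      case False
      then have lt: "len ?l < p" by simp
      define q where "q = (p - len ?l - 1) mod len ?r + 1"
      obtain zs where zs: "take p (yield x) = zs @ yield ?l @ take q (yield ?r)"
        using take_right(6,7)[OF ok h lt p(2)] unfolding q_def by auto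
      show ?thesis
      proof (rule access_right[OF less.prems(1) h lt, folded q_def])
        fix R' assume st: "access_state R0 R' ?r q"
        then have "take q (yield ?r) \<noteq> []" by (auto simp: access_state_def)
        with zs have "last (take q (yield ?r)) = last (take p (yield x))" by simp
        with st have "run (25 * (height ?r + 1) + t) (67, R') = Some v"
          using hc less.prems(2) by (intro less.hyps) auto
        then show "run (25 * height x + t) (67, R') = Some v"
          by (rule exec_mono) (use hc in simp)
      qed
    qed
    then show ?thesis by (simp add: add.assoc)
  qed
qed

end

section \<open>The four queries\<close>

locale query_index = index +
  fixes e :: "'a::linorder expr" and w :: "'a list" and H :: nat
  assumes e_E: "e \<in> E" "mirror e \<in> E"
    and yield_e: "yield e = w" and length_w: "length w = n"
    and height_e: "height e \<le> H"
    and M_roots: "M ! 0 = Word (ad e)" "M ! Suc 0 = Word (ad (mirror e))"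
begin

lemma run_psv':
  assumes "R 0 = Word i" "R 1 = Sym d" "R 4 = Word 0" "R 5 = Word 0" "R 8 = Word 0" "R 9 = Word 0"
    "1 \<le> i" "i \<le> n"
  shows "run (20 + (45 * (3 * H + 2))) (45, R) = Some (Word (psv' w i d))"
proof -
  have M0: "0 < length M" "Suc 0 < length M" "0 < b"
    using ad_less[OF e_E(1)] n_less by (auto intro: Nat.gr0I)
  have len: "len e = n" by (simp add: yield_e length_w)
  show ?thesis
  proof (cases "i = 1")
    \<comment> \<open>The prefix before position 1 is empty, which the invariant
      \<open>1 \<le> p\<close> excludes, so the program answers without entering the loop.\<close>
    case True
    then have v: "psv' w i d = 0" by (simp add: psv'_last_small last_small_none small_in_def)
    show ?thesis
      apply (subst exec_num)
      using assms M0 M_roots True n_less v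
      apply (simp add: exec_run prog_nth sub_word)
      apply (rule exec_mono[OF exit[where t = 0 and v = 0 and fl = 0, unfolded result_def, simplified]])
           apply simp_all
      done
  next
    case False
    have "run (45 * (height e + 2 * H + 2)) (1, R') = Some (Word (psv' w i d))"
      if "state 0 d R' e (i - 1) 0 None" for R'
      using search[OF that height_e] assms(7) by (simp add: result_def found_def psv'_last_small yield_e last_small_none)
    then have *: "run (45 * (3 * H + 2)) (1, R') = Some (Word (psv' w i d))"
      if "state 0 d R' e (i - 1) 0 None" for R'
      by (rule exec_mono[OF _ _]) (use that height_e in auto)
    show ?thesis
      apply (subst exec_num)
      using assms M0 M_roots False n_less
      apply (simp add: exec_run prog_nth sub_word)
      apply (rule exec_mono[OF *[unfolded One_nat_def]])
       apply (auto simp: state_def fallback_def e_E len)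
      done
  qed
qed

lemma run_nsv':
  assumes "R 0 = Word i" "R 1 = Sym d" "R 4 = Word 0" "R 5 = Word 0" "R 8 = Word 0"
    "1 \<le> i" "i \<le> n"
  shows "run (20 + (45 * (3 * H + 2))) (51, R) = Some (Word (nsv' w i d))"
proof -
  have M0: "0 < length M" "Suc 0 < length M" "0 < b"
    using ad_less[OF e_E(1)] n_less by (auto intro: Nat.gr0I)
  have len: "len (mirror e) = n" by (simp add: yield_e length_w yield_mirror)
  note M = M_len[OF e_E(2)] ad_less[OF e_E(2)] len length_M
  show ?thesis
  proof (cases "i = n")
    case True
    then have v: "nsv' w i d = Suc n"
      using assms(6,7) by (simp add: nsv'_last_small last_small_none small_in_def length_w)
    show ?thesis
      apply (subst exec_num)
      using assms M0 M_roots M True n_less v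
      apply (simp add: exec_run prog_nth sub_word)
      apply (rule exec_mono[OF exit[where t = 0 and v = 0 and fl = 1, unfolded result_def, simplified]])
           apply simp_all
      done
  next
    case False
    have "run (45 * (height (mirror e) + 2 * H + 2)) (1, R') = Some (Word (nsv' w i d))"
      if "state 1 d R' (mirror e) (n - i) 0 None" for R'
      using search[OF that, of H] assms(6,7) height_e
      by (auto simp: result_def found_def nsv'_last_small length_w yield_e yield_mirror last_small_none height_mirror)
    then have *: "run (45 * (3 * H + 2)) (1, R') = Some (Word (nsv' w i d))"
      if "state 1 d R' (mirror e) (n - i) 0 None" for R'
      by (rule exec_mono[OF _ _]) (use that height_e in \<open>auto simp: height_mirror\<close>)
    show ?thesis
      apply (subst exec_num)
      using assms M0 M_roots M False n_less
      apply (simp add: exec_run prog_nth sub_word)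
      apply (rule exec_mono[OF *[unfolded One_nat_def]])
       apply (auto simp: state_def fallback_def e_E len)
      done
  qed
qed

text \<open>\<open>psv\<close> and \<open>nsv\<close> are the primed queries for the symbol at
  \<open>i\<close> itself. Random access loads this symbol into cell 1, and the flag in cell 9
  selects the continuation.\<close>

lemma run_access:
  assumes "R 0 = Word i" "R 4 = Word 0" "R 5 = Word 0" "R 7 = Word 1" "R 8 = Word 0" "R 9 = Word fl"
    "1 \<le> i" "i \<le> n" "fl = 0 \<or> fl = 1"
  shows "run (5 + (25 * (H + 1) + (5 + (20 + (45 * (3 * H + 2)))))) (65, R) =
    Some (Word (if fl = 0 then psv w i else nsv w i))"
proof -
  have M0: "0 < length M" using ad_less[OF e_E(1)] by auto
  have len: "len e = n" by (simp add: yield_e length_w)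
  define v where "v = (if fl = 0 then psv w i else nsv w i)"
  have sym: "last (take i (yield e)) = at_pos w i"
    using assms(7,8) length_w by (cases i) (auto simp: yield_e at_pos_def take_Suc_conv_app_nth)
  have pn: "psv w i = psv' w i (at_pos w i)" "nsv w i = nsv' w i (at_pos w i)"
    by (simp_all add: psv_def psv'_def nsv_def nsv'_def)
  have cont: "run (5 + (20 + (45 * (3 * H + 2)))) (72, R') = Some (Word v)"
    if "R' 1 = Sym (last (take i (yield e)))" "R' 7 = Word 1" "R' 8 = Word 0" "\<forall>k\<in>{0, 4, 5, 9}. R' k = R k" for R'
  proof (cases "fl = 0")
    case True
    have "run (20 + (45 * (3 * H + 2))) (45, R') = Some (Word v)"
      unfolding v_def using True pn by (simp only: simp_thms if_True)
        (rule run_psv', use assms that True in \<open>auto simp: sym\<close>)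
    then have "run (3 + (20 + (45 * (3 * H + 2)))) (45, R') = Some (Word v)"
      by (rule exec_mono) simp
    then show ?thesis
      apply (subst exec_num)
      using that assms True
      apply (simp add: prog_nth)
      apply (subst exec_num)
      apply (simp add: prog_nth)
      done
  next
    case False
    then have fl: "fl = 1" using assms(9) by simp
    have "run (20 + (45 * (3 * H + 2))) (51, R') = Some (Word v)"
      unfolding v_def using False pn by (simp only: if_False)
        (rule run_nsv', use assms that False in \<open>auto simp: sym\<close>)
    then have "run (4 + (20 + (45 * (3 * H + 2)))) (51, R') = Some (Word v)"
      by (rule exec_mono) simp
    then show ?thesis
      apply (subst exec_num)
      using that assms fl
      apply (simp add: prog_nth)
      done
  qed
  have acc: "run (25 * (H + 1) + (5 + (20 + (45 * (3 * H + 2))))) (67, R') = Some (Word v)"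
    if "access_state R R' e i" for R'
    by (rule exec_mono[OF access[OF that cont]]) (use height_e in auto)
  show ?thesis
    unfolding v_def[symmetric]
    apply (subst exec_num)
    using assms M0 M_roots
    apply (simp add: exec_run prog_nth)
    apply (rule exec_mono[OF acc])
     apply (use e_E len assms in \<open>simp add: access_state_def\<close>)
    apply simp
    done
qed

text \<open>Per unit of height, \<open>3 * 45\<close> steps for the search and 25 for the random
  access.\<close>

abbreviation time :: nat where
  "time \<equiv> 160 * H + 160"

lemma b_pos: "0 < b"
  using n_less by (auto intro: Nat.gr0I)

lemma answers_psv':
  assumes "entry = 45" "1 \<le> i" "i \<le> n"
  shows "answers b M (prog entry) time [Word i, Sym d] (psv' w i d)"
proof -
  have "run (20 + 45 * (3 * H + 2)) (45, load [Word i, Sym d]) = Some (Word (psv' w i d))"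
    by (rule run_psv') (use assms(2,3) in simp_all)
  then have "run (2 + (20 + 45 * (3 * H + 2))) (0, load [Word i, Sym d]) = Some (Word (psv' w i d))"
    by (subst exec_num) (auto simp: prog_nth assms(1) elim!: exec_mono)
  then show ?thesis unfolding answers_def by (rule exec_mono) simp
qed

lemma answers_nsv':
  assumes "entry = 51" "1 \<le> i" "i \<le> n"
  shows "answers b M (prog entry) time [Word i, Sym d] (nsv' w i d)"
proof -
  have "run (20 + 45 * (3 * H + 2)) (51, load [Word i, Sym d]) = Some (Word (nsv' w i d))"
    by (rule run_nsv') (use assms(2,3) in simp_all)
  then have "run (2 + (20 + 45 * (3 * H + 2))) (0, load [Word i, Sym d]) = Some (Word (nsv' w i d))"
    by (subst exec_num) (auto simp: prog_nth assms(1) elim!: exec_mono)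
  then show ?thesis unfolding answers_def by (rule exec_mono) simp
qed

lemma answers_psv:
  assumes "entry = 61" "1 \<le> i" "i \<le> n"
  shows "answers b M (prog entry) time [Word i] (psv w i)"
  unfolding answers_def
  apply (rule exec_mono[where t = "5 + (5 + (25 * (H + 1) + (5 + (20 + (45 * (3 * H + 2))))))"])
   apply (subst exec_num, simp add: prog_nth assms(1))
   apply (subst exec_num, simp add: prog_nth assms(1) b_pos)
   apply (subst exec_num, simp add: prog_nth assms(1))
   apply (rule exec_mono[OF run_access[of _ i 0, unfolded assms(1), simplified if_True simp_thms]])
  using assms apply simp_all
  done

lemma answers_nsv:
  assumes "entry = 63" "1 \<le> i" "i \<le> n"
  shows "answers b M (prog entry) time [Word i] (nsv w i)"
  unfolding answers_def
  apply (rule exec_mono[where t = "5 + (5 + (25 * (H + 1) + (5 + (20 + (45 * (3 * H + 2))))))"])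
   apply (subst exec_num, simp add: prog_nth assms(1))
   apply (subst exec_num, simp add: prog_nth assms(1) b_pos)
   apply (subst exec_num, simp add: prog_nth assms(1) b_pos)
   apply (rule exec_mono[OF run_access[of _ i 1, unfolded assms(1), simplified if_False simp_thms one_neq_zero]])
  using assms apply simp_all
  done

end

subsection \<open>The index\<close>

definition record_cell :: "('a::linorder expr \<Rightarrow> nat) \<Rightarrow> 'a expr \<Rightarrow> nat \<Rightarrow> 'a cell" where
  "record_cell ad x j = (if j = 0 then Sym (min_sym x) else if j = 1 then Word (len x)
     else if height x = 0 then Word 0 else if j = 2 then Word (ad (left_child x)) else Word (ad (right_child x)))"

definition cells :: "('a::linorder expr \<Rightarrow> nat) \<Rightarrow> (nat \<Rightarrow> 'a expr) \<Rightarrow> 'a expr \<Rightarrow> nat \<Rightarrow> 'a cell list" where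
  "cells ad node e m = Word (ad e) # Word (ad (mirror e)) #
     map (\<lambda>k. record_cell ad (node (k div 4)) (k mod 4)) [0..<4 * m]"

text \<open>Six bits on top of \<open>floor_log n\<close> allow more than \<open>32 * n\<close>
  addresses, enough for the index of fewer than \<open>16 * n + 2\<close> cells.\<close>

definition word_bits :: "nat \<Rightarrow> nat" where
  "word_bits n = floor_log n + 6"

lemma word_bits_gt: "0 < n \<Longrightarrow> 32 * n < 2 ^ word_bits n"
  using floor_log_exp2_gt[of n] by (simp add: word_bits_def power_add)

lemma len_subs: "ok x \<Longrightarrow> y \<in> subs x \<Longrightarrow> len y \<le> len x"
proof (induction x)
  case (Rep x t)
  have "len x \<le> t * len x" using Rep.prems(1) by (cases t) auto
  with Rep show ?case by (auto intro: order_trans)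
qed auto

text \<open>The expression and its mirror image have at most \<open>2 * 9 * g_rl w\<close> nodes of
  four cells each, and two cells hold the roots: at most 72 + 2 times \<open>g_rl w\<close>.\<close>

lemma index_exists:
  fixes w :: "'a::linorder list"
  assumes "w \<noteq> []"
  obtains E ad e M where
    "query_index (word_bits (length w)) (length w) M E ad e w (25 * floor_log (length w))"
    "length M \<le> 74 * g_rl w" "\<forall>c\<in>set M. cell_fits (word_bits (length w)) c"
proof -
  obtain e where e: "ok e" "yield e = w" "card (subs e) \<le> 9 * g_rl w"
    "height e \<le> 25 * floor_log (length w)"
    using balanced_expr[OF assms] by blast
  define E where "E = subs e \<union> subs (mirror e)"
  define n where "n = length w"
  define b where "b = word_bits n"
  define m where "m = card E"
  have n0: "0 < n" using assms by (simp add: n_def)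
  have "card (subs (mirror e)) \<le> card (subs e)" by (simp add: subs_mirror card_image_le)
  then have "m \<le> 2 * card (subs e)"
    unfolding m_def E_def using card_Un_le[of "subs e" "subs (mirror e)"] by linarith
  moreover have "card (subs e) < 2 * n" using card_subs_le[OF e(1)] e(2) by (simp add: n_def)
  ultimately have m: "m \<le> 18 * g_rl w" "m < 4 * n" using e(3) by linarith+
  have "0 < card (subs e)" using self_subs[of e] by (auto simp: card_gt_0_iff simp del: self_subs)
  with e(3) have g0: "0 < g_rl w" by simp
  have fin: "finite E" by (simp add: E_def)
  obtain ix where ix: "bij_betw ix E {0..<m}"
    using ex_bij_betw_finite_nat[OF fin] by (auto simp: m_def)
  define node where "node = inv_into E ix"
  define ad where "ad x = 2 + 4 * ix x" for x
  define M where "M = cells ad node e m"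
  have node: "node (ix x) = x" "ix x < m" if "x \<in> E" for x
    using that ix by (auto simp: node_def bij_betw_def)
  have nodeE: "node k \<in> E" if "k < m" for k
    using that ix unfolding node_def bij_betw_def by (metis atLeastLessThan_iff inv_into_into zero_le)
  have lM: "length M = 4 * m + 2" by (simp add: M_def cells_def)
  have lb: "length M < 2 ^ b" using m(2) word_bits_gt[OF n0] lM by (simp add: b_def)
  have MM: "M ! (ad x + j) = record_cell ad x j" if "x \<in> E" "j < 4" for x j
  proof -
    have "4 * ix x + j < 4 * m" using node(2)[OF that(1)] that(2) by linarith
    then show ?thesis using that node(1)[OF that(1)]
      by (simp add: M_def cells_def ad_def del: upt_Suc)
  qed
  have adl: "ad x + 3 < length M" if "x \<in> E" for x
    using node(2)[OF that] by (simp add: lM ad_def)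
  have okE: "ok x" if "x \<in> E" for x
    using that ok_subs e(1) ok_mirror[of e] by (auto simp: E_def)
  have clE: "subs x \<subseteq> E" if "x \<in> E" for x
    using that subs_trans by (auto simp: E_def)
  have lenE: "len x \<le> n" if "x \<in> E" for x
    using that len_subs[of e x] len_subs[of "mirror e" x] e(1,2) ok_mirror[of e]
    by (auto simp: E_def n_def yield_mirror)
  have eE: "e \<in> E" "mirror e \<in> E" by (simp_all add: E_def)
  have nb: "n + 1 < 2 ^ b" using word_bits_gt[OF n0] n0 by (simp add: b_def)
  have qi: "query_index b n M E ad e w (25 * floor_log n)"
  proof
    fix x assume x: "x \<in> E"
    show "M ! ad x = Sym (min_sym x)" using MM[OF x, of 0] by (simp add: record_cell_def)
    show "M ! Suc (ad x) = Word (len x)" using MM[OF x, of 1] by (simp add: record_cell_def)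
    show "M ! Suc (Suc (ad x)) = Word (if height x = 0 then 0 else ad (left_child x))"
      using MM[OF x, of 2] by (simp add: record_cell_def)
    show "M ! Suc (Suc (Suc (ad x))) = Word (if height x = 0 then 0 else ad (right_child x))"
      using MM[OF x, of 3] by (simp add: record_cell_def numeral_3_eq_3)
    show "0 < ad x" by (simp add: ad_def)
  next
    show "M ! 0 = Word (ad e)" "M ! Suc 0 = Word (ad (mirror e))"
      by (simp_all add: M_def cells_def)
  qed (use e eE okE clE adl lb nb n_def in auto)
  have lM': "length M \<le> 74 * g_rl w" using m(1) g0 lM by simp
  have fits: "\<forall>c\<in>set M. cell_fits b c"
  proof
    have ad_b: "ad x < 2 ^ b" if "x \<in> E" for x using adl[OF that] lb by linarith
    fix c assume "c \<in> set M"
    then consider "c = Word (ad e) \<or> c = Word (ad (mirror e))"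
      | k where "k < 4 * m" "c = record_cell ad (node (k div 4)) (k mod 4)"
      by (auto simp: M_def cells_def)
    then show "cell_fits b c"
    proof cases
      case 1
      then show ?thesis using ad_b eE by auto
    next
      case 2
      then have x: "node (k div 4) \<in> E" by (intro nodeE) simp
      let ?x = "node (k div 4)"
      have "len ?x < 2 ^ b" using lenE[OF x] nb by linarith
      moreover have "left_child ?x \<in> E \<and> right_child ?x \<in> E" if "0 < height ?x"
        using children_subs[OF that] clE[OF x] by blast
      ultimately show ?thesis using 2(2) ad_b by (auto simp: record_cell_def)
    qed
  qed
  show ?thesis by (rule that[OF qi[unfolded b_def n_def] lM' fits[unfolded b_def n_def]])
qed

lemma word_length_bits: "word_length word_bits"
  unfolding word_length_def
proof
  show "\<forall>n. n + 1 < 2 ^ word_bits n"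
  proof
    fix n show "n + 1 < 2 ^ word_bits n"
      using word_bits_gt[of n] by (cases "n = 0") (simp_all add: word_bits_def)
  qed
  have fl: "real (floor_log n) \<le> log 2 (real n)" "log 2 (real n) \<le> real (floor_log n) + 1" if "1 \<le> n" for n
    using that by (auto simp: floor_log_altdef zero_le_log_cancel_iff)
  show "(\<lambda>n. real (word_bits n)) \<in> \<Theta>(\<lambda>n. log 2 (real n))"
  proof (intro bigthetaI landau_o.bigI[of 7] landau_omega.bigI[of 1])
    show "\<forall>\<^sub>F n in sequentially. norm (real (word_bits n)) \<le> 7 * norm (log 2 (real n))"
      using eventually_ge_at_top[of 2]
    proof eventually_elim
      case (elim n)
      then have "1 \<le> log 2 (real n)" by simp
      then show ?case using fl(1)[of n] elim by (simp add: word_bits_def del: one_le_log_cancel_iff)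
    qed
    show "\<forall>\<^sub>F n in sequentially. 1 * norm (log 2 (real n)) \<le> norm (real (word_bits n))"
      using eventually_ge_at_top[of 2]
    proof eventually_elim
      case (elim n)
      then have "1 \<le> log 2 (real n)" by simp
      then show ?case using fl(2)[of n] elim by (simp add: word_bits_def del: one_le_log_cancel_iff)
    qed
  qed simp_all
qed

text \<open>The factor is 160 steps times height 25; from \<open>n = 2\<close> on the logarithm is
  at least 1 and absorbs the constant.\<close>

definition time_bound :: "nat \<Rightarrow> nat" where
  "time_bound n = 4000 * floor_log n + 200"

lemma time_bound_bigo: "(\<lambda>n. real (time_bound n)) \<in> O(\<lambda>n. log 2 (real n))"
proof (rule landau_o.bigI[of 4200])
  show "\<forall>\<^sub>F n in sequentially. norm (real (time_bound n)) \<le> 4200 * norm (log 2 (real n))"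
    using eventually_ge_at_top[of 2]
  proof eventually_elim
    case (elim n)
    then have "1 \<le> log 2 (real n)" by simp
    moreover from this elim have "real (floor_log n) \<le> log 2 (real n)"
      by (simp add: floor_log_altdef)
    ultimately show ?case by (simp add: time_bound_def del: one_le_log_cancel_iff)
  qed
qed simp

theorem theorem4:
  "\<exists>P_psv P_nsv P_psv' P_nsv' :: instr list. \<exists>b S T :: nat \<Rightarrow> nat.
     word_length b \<and>
     (\<lambda>g. real (S g)) \<in> O(\<lambda>g. real g) \<and>
     (\<lambda>n. real (T n)) \<in> O(\<lambda>n. log 2 (real n)) \<and>
     (\<forall>w :: 'a::linorder list. w \<noteq> [] \<longrightarrow>
        (let n = length w in
         \<exists>M :: 'a cell list.
           length M \<le> S (g_rl w) \<and> (\<forall>c \<in> set M. cell_fits (b n) c) \<and>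
           (\<forall>i \<in> {1..n}.
              answers (b n) M P_psv (T n) [Word i] (psv w i) \<and>
              answers (b n) M P_nsv (T n) [Word i] (nsv w i) \<and>
              (\<forall>d. answers (b n) M P_psv' (T n) [Word i, Sym d] (psv' w i d) \<and>
                   answers (b n) M P_nsv' (T n) [Word i, Sym d] (nsv' w i d)))))"
proof (intro exI conjI allI impI)
  show "word_length word_bits" by (rule word_length_bits)
  show "(\<lambda>g. real (74 * g)) \<in> O(\<lambda>g. real g)" by simp
  show "(\<lambda>n. real (time_bound n)) \<in> O(\<lambda>n. log 2 (real n))" by (rule time_bound_bigo)
  fix w :: "'a list" assume "w \<noteq> []"
  define n where "n = length w"
  obtain E ad e M where
    ix: "query_index (word_bits n) n M E ad e w (25 * floor_log n)"
    and M: "length M \<le> 74 * g_rl w" "\<forall>c\<in>set M. cell_fits (word_bits n) c"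
    by (rule index_exists[OF \<open>w \<noteq> []\<close>, folded n_def])
  have time: "answers b M P (160 * (25 * floor_log n) + 160) args v \<Longrightarrow>
      answers b M P (time_bound n) args v" for b and M :: "'a cell list" and P args v
    unfolding answers_def by (erule exec_mono) (simp add: time_bound_def)
  have "\<forall>i\<in>{1..n}. answers (word_bits n) M (prog 61) (time_bound n) [Word i] (psv w i) \<and>
      answers (word_bits n) M (prog 63) (time_bound n) [Word i] (nsv w i) \<and>
      (\<forall>d. answers (word_bits n) M (prog 45) (time_bound n) [Word i, Sym d] (psv' w i d) \<and>
           answers (word_bits n) M (prog 51) (time_bound n) [Word i, Sym d] (nsv' w i d))"
    by (intro ballI conjI allI time query_index.answers_psv[OF ix] query_index.answers_nsv[OF ix]
        query_index.answers_psv'[OF ix] query_index.answers_nsv'[OF ix]) simp_all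
  with M show "let n = length w in \<exists>M :: 'a cell list.
      length M \<le> 74 * g_rl w \<and> (\<forall>c\<in>set M. cell_fits (word_bits n) c) \<and>
      (\<forall>i\<in>{1..n}. answers (word_bits n) M (prog 61) (time_bound n) [Word i] (psv w i) \<and>
        answers (word_bits n) M (prog 63) (time_bound n) [Word i] (nsv w i) \<and>
        (\<forall>d. answers (word_bits n) M (prog 45) (time_bound n) [Word i, Sym d] (psv' w i d) \<and>
             answers (word_bits n) M (prog 51) (time_bound n) [Word i, Sym d] (nsv' w i d)))"
    unfolding Let_def n_def[symmetric] by (intro exI[of _ M] conjI)
qed

end
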